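(* For every positive integer $n$ (treated as a constant), the $n$-dimensional oriented grid can be explored by (1) $4$ synchronous agents with exploration cost $O(V(D)^2)$, and (2) $5$ semi-synchronous agents with exploration cost $O(V(D)^3)$, where a treasure is hidden at an unknown cell at $\ell_1$-distance $D$ from the origin and $V(D)=\Theta(D^n)$ is the number of cells of the $\ell_1$-ball of radius $D$ around the origin.
   Context: The $n$-dimensional grid has vertex set (cells) $\mathbb{Z}^n$; two cells are adjacent if they differ by exactly $1$ in exactly one coordinate; distance is the $\ell_1$ (Manhattan) distance. The grid is oriented: an agent can move in any of the $2n$ global directions $(\pm1,i)$ or stay. Agents all start at the origin, cannot distinguish cells, and each is governed by the same deterministic finite automaton with state set $Q$ (possibly different initial states), with transition function $\delta: Q\times 2^Q\to Q\times(\{-1,+1\}\times\{0,1,\dots,n\})$: an agent observes the set of states of agents in its cell and chooses a new state and a move (dimension $0$ meaning stay). Time proceeds in discrete steps; each active agent performs one atomic look-compute-move cycle per step. In the synchronous model all agents are active every step; in the semi-synchronous model an adversary chooses the active subset each step, subject to each agent being active infinitely often. The task is to find a treasure hidden in some cell at distance $D$ from the origin ($D$ unknown to the agents). In the synchronous model the exploration cost is the number of time steps until some agent reaches the treasure's cell; in the semi-synchronous model it is the total distance traveled by all agents until then. *)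

theory Defs
  imports Main
begin

(* Cells of the n-dimensional grid: integer lists of length n. *)
type_synonym cell = "int list"

(* A move (s, i): s \<in> {-1,+1}, i \<in> {0..n}; i = 0 means stay,
   i \<ge> 1 means change coordinate i (list index i-1) by s. *)
type_synonym move = "int \<times> nat"

(* A configuration: agent index \<Rightarrow> (state, position). *)
type_synonym 'q config = "nat \<Rightarrow> 'q \<times> cell"

definition l1 :: "cell \<Rightarrow> nat" where
  "l1 x = nat (sum_list (map abs x))"

definition ball_card :: "nat \<Rightarrow> nat \<Rightarrow> nat" where
  "ball_card n D = card {x :: cell. length x = n \<and> l1 x \<le> D}"

definition apply_move :: "move \<Rightarrow> cell \<Rightarrow> cell" where
  "apply_move mv p = (if snd mv = 0 then p else p[snd mv - 1 := p ! (snd mv - 1) + fst mv])"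

definition move_len :: "move \<Rightarrow> nat" where
  "move_len mv = (if snd mv = 0 then 0 else 1)"

definition automaton :: "nat \<Rightarrow> 'q set \<Rightarrow> ('q \<Rightarrow> 'q set \<Rightarrow> 'q \<times> move) \<Rightarrow> bool" where
  "automaton n Q \<delta> \<longleftrightarrow> finite Q \<and>
     (\<forall>q\<in>Q. \<forall>X. X \<subseteq> Q \<longrightarrow>
        fst (\<delta> q X) \<in> Q \<and> fst (snd (\<delta> q X)) \<in> {-1, 1} \<and> snd (snd (\<delta> q X)) \<le> n)"

definition observe :: "nat \<Rightarrow> 'q config \<Rightarrow> nat \<Rightarrow> 'q set" where
  "observe m c k = {fst (c j) | j. j < m \<and> snd (c j) = snd (c k)}"

definition step :: "('q \<Rightarrow> 'q set \<Rightarrow> 'q \<times> move) \<Rightarrow> nat \<Rightarrow> nat set \<Rightarrow> 'q config \<Rightarrow> 'q config" where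
  "step \<delta> m A c = (\<lambda>k. if k \<in> A \<and> k < m then
       (fst (\<delta> (fst (c k)) (observe m c k)),
        apply_move (snd (\<delta> (fst (c k)) (observe m c k))) (snd (c k)))
     else c k)"

primrec run :: "nat \<Rightarrow> ('q \<Rightarrow> 'q set \<Rightarrow> 'q \<times> move) \<Rightarrow> 'q list \<Rightarrow> (nat \<Rightarrow> nat set) \<Rightarrow> nat \<Rightarrow> 'q config" where
  "run n \<delta> init S 0 = (\<lambda>k. (init ! k, replicate n 0))"
| "run n \<delta> init S (Suc t) = step \<delta> (length init) (S t) (run n \<delta> init S t)"

definition travelled :: "nat \<Rightarrow> ('q \<Rightarrow> 'q set \<Rightarrow> 'q \<times> move) \<Rightarrow> 'q list \<Rightarrow> (nat \<Rightarrow> nat set) \<Rightarrow> nat \<Rightarrow> nat" where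
  "travelled n \<delta> init S t =
     (\<Sum>\<tau><t. \<Sum>k\<in>S \<tau> \<inter> {..<length init}.
        move_len (snd (\<delta> (fst (run n \<delta> init S \<tau> k)) (observe (length init) (run n \<delta> init S \<tau>) k))))"

definition fair :: "nat \<Rightarrow> (nat \<Rightarrow> nat set) \<Rightarrow> bool" where
  "fair m S \<longleftrightarrow> (\<forall>k<m. infinite {t. k \<in> S t})"

definition reached :: "nat \<Rightarrow> ('q \<Rightarrow> 'q set \<Rightarrow> 'q \<times> move) \<Rightarrow> 'q list \<Rightarrow> (nat \<Rightarrow> nat set) \<Rightarrow> nat \<Rightarrow> cell \<Rightarrow> bool" where
  "reached n \<delta> init S t x \<longleftrightarrow> (\<exists>k<length init. snd (run n \<delta> init S t k) = x)"

end

theory Submission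
  imports Defs "HOL-Library.Nat_Bijection"
begin

text \<open>A Peano-type path in base 3 fills cubes of an orthant by unit steps, and its \<open>N\<close>-th step can be
  read off from \<open>N = 3^j * u\<close> with \<open>u\<close> prime to 3: move in dimension \<open>j mod n\<close> in the direction of
  the current sign of that dimension, then flip the signs of all other dimensions. At \<open>u = 2\<close> all
  signs are flipped instead, so that the path is retraced to the origin; at \<open>u = 1\<close> the next orthant
  is chosen. Since the orthants recur with constant period \<open>2^n\<close>, a cell at distance \<open>D\<close> is reached
  for some \<open>N = O(D^n) = O(V(D))\<close>.

  The number \<open>N\<close> is stored as the distance between an agent \<open>B\<close> (on the current cell) and an agent \<open>Y\<close>
  on a line; a scratch agent \<open>X\<close> starts at \<open>Y\<close>, its distance to \<open>B\<close> is divided by 3 until this is no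
  longer possible, and it is then carried back to \<open>Y\<close>. A controller \<open>C\<close> walks along the line and gives
  the orders. With synchronous agents, speeds in ratio 2:1 let \<open>C\<close> and \<open>X\<close> meet at a third of the
  distance in linear time; in the semi-synchronous model \<open>C\<close> instead moves \<open>X\<close> and a fourth
  passive agent \<open>Z\<close> alternately towards each other, in quadratic time. Hence \<open>N\<close> steps cost
  \<open>O(N^2)\<close> and \<open>O(N^3)\<close>. In the second case only one agent is able to act at any time, so the
  adversary can merely delay the run.\<close>

section \<open>The base-3 walk\<close>

fun val3 :: "nat \<Rightarrow> nat" where
  "val3 x = (if 0 < x \<and> x mod 3 = 0 then Suc (val3 (x div 3)) else 0)"

fun core3 :: "nat \<Rightarrow> nat" where
  "core3 x = (if 0 < x \<and> x mod 3 = 0 then core3 (x div 3) else x)"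

declare val3.simps [simp del] core3.simps [simp del]

lemma val3_triple: "0 < x \<Longrightarrow> val3 (3 * x) = Suc (val3 x)"
  by (subst val3.simps) simp

lemma core3_triple: "0 < x \<Longrightarrow> core3 (3 * x) = core3 x"
  by (subst core3.simps) simp

lemma core3_pos: "0 < x \<Longrightarrow> 0 < core3 x"
  by (induction x rule: core3.induct) (subst core3.simps, auto)

lemma val3_power: "0 < u \<Longrightarrow> u mod 3 \<noteq> 0 \<Longrightarrow> val3 (u * 3 ^ m) = m"
proof (induction m)
  case 0
  then show ?case by (simp add: val3.simps)
next
  case (Suc m)
  then show ?case using val3_triple[of "u * 3 ^ m"] by (simp add: mult.left_commute)
qed

lemma core3_power: "0 < u \<Longrightarrow> u mod 3 \<noteq> 0 \<Longrightarrow> core3 (u * 3 ^ m) = u"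
proof (induction m)
  case 0
  then show ?case by (simp add: core3.simps)
next
  case (Suc m)
  then show ?case using core3_triple[of "u * 3 ^ m"] by (simp add: mult.left_commute)
qed

text \<open>As \<open>0 < r < 3 ^ m\<close>, the last nonzero base-3 digit is among the lowest
  \<open>m\<close>, which a multiple of \<open>3 ^ m\<close> leaves alone. This makes the path
  self-similar.\<close>

lemma val3_add: "0 < r \<Longrightarrow> r < 3 ^ m \<Longrightarrow> val3 (k * 3 ^ m + r) = val3 r"
proof (induction m arbitrary: r)
  case (Suc m)
  have [simp]: "(k * (3 * 3 ^ m) + r) mod 3 = r mod 3"
    using mod_mult_self4[of 3 "k * 3 ^ m" r] by (simp only: mult.left_commute)
  show ?case
  proof (cases "r mod 3 = 0")
    case True
    then obtain r' where r: "r = 3 * r'" by auto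
    have "k * 3 ^ Suc m + r = 3 * (k * 3 ^ m + r')" by (simp add: r)
    then have "val3 (k * 3 ^ Suc m + r) = Suc (val3 (k * 3 ^ m + r'))"
      using val3_triple[of "k * 3 ^ m + r'"] Suc.prems r by (metis add_gr_0 gr0I mult_0_right)
    also have "\<dots> = Suc (val3 r')" using Suc by (simp add: r)
    finally show ?thesis using Suc.prems by (simp add: r val3_triple)
  next
    case False
    then show ?thesis by (simp add: val3.simps[of r] val3.simps[of "k * (3 * 3 ^ m) + r"])
  qed
qed simp

text \<open>Fewer than \<open>m\<close> factors 3 split off, so the core keeps a nonzero multiple of
  3 coming from \<open>k\<close>. The special values 1 and 2 thus do not occur strictly between
  consecutive positive multiples of \<open>3 ^ m\<close>.\<close>

lemma core3_add: "0 < k \<Longrightarrow> 0 < r \<Longrightarrow> r < 3 ^ m \<Longrightarrow> core3 (k * 3 ^ m + r) > 2"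
proof (induction m arbitrary: r)
  case (Suc m)
  have [simp]: "(k * (3 * 3 ^ m) + r) mod 3 = r mod 3"
    using mod_mult_self4[of 3 "k * 3 ^ m" r] by (simp only: mult.left_commute)
  show ?case
  proof (cases "r mod 3 = 0")
    case True
    then obtain r' where r: "r = 3 * r'" by auto
    have "k * 3 ^ Suc m + r = 3 * (k * 3 ^ m + r')" by (simp add: r)
    then have "core3 (k * 3 ^ Suc m + r) = core3 (k * 3 ^ m + r')"
      using core3_triple[of "k * 3 ^ m + r'"] Suc.prems r by (metis add_gr_0 gr0I mult_0_right)
    then show ?thesis using Suc by (simp add: r)
  next
    case False
    have "k * 3 ^ m \<ge> 1" using Suc.prems by (simp add: Suc_le_eq)
    moreover have "k * (3 * 3 ^ m) = 3 * (k * 3 ^ m)" by simp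
    ultimately have "k * (3 * 3 ^ m) + r > 2" using Suc.prems by linarith
    with False show ?thesis by (simp add: core3.simps[of "k * (3 * 3 ^ m) + r"])
  qed
qed simp

section \<open>The Peano path and the boxes it fills\<close>

type_synonym signed_cell = "nat set \<times> cell"

definition heading :: "nat \<Rightarrow> nat set \<Rightarrow> move" where
  "heading i F = (if i \<in> F then -1 else 1, Suc i)"

definition flip_others :: "nat \<Rightarrow> nat \<Rightarrow> nat set \<Rightarrow> nat set" where
  "flip_others n i F = {k. k < n \<and> ((k \<in> F) = (k = i))}"

definition peano_step :: "nat \<Rightarrow> nat \<Rightarrow> signed_cell \<Rightarrow> signed_cell" where
  "peano_step n i = (\<lambda>(F, p). (flip_others n i F, apply_move (heading i F) p))"

primrec peano :: "nat \<Rightarrow> signed_cell \<Rightarrow> nat \<Rightarrow> signed_cell" where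
  "peano n s 0 = s"
| "peano n s (Suc r) = peano_step n (val3 (Suc r) mod n) (peano n s r)"

text \<open>For \<open>k < n\<close> the exponent is the number of \<open>l < m\<close> with
  \<open>l mod n = k\<close>: how often dimension \<open>k\<close> is tripled on the way to level
  \<open>m\<close>.\<close>

definition side :: "nat \<Rightarrow> nat \<Rightarrow> nat \<Rightarrow> nat" where
  "side n m k = 3 ^ ((m + (n - 1 - k)) div n)"

lemma side_0: "k < n \<Longrightarrow> side n 0 k = 1"
  by (simp add: side_def)

lemma side_Suc:
  assumes "k < n"
  shows "side n (Suc m) k = (if m mod n = k then 3 * side n m k else side n m k)"
proof -
  define a where "a = m + (n - 1 - k)"
  have "Suc a = m + (n - k)" using assms by (simp add: a_def)
  moreover have "(m + (n - k)) mod n = 0 \<longleftrightarrow> m mod n = k"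
  proof
    assume "(m + (n - k)) mod n = 0"
    then have "(m + (n - k) + k) mod n = k"
      using assms by (metis add_0 mod_add_left_eq mod_less)
    moreover have "m + (n - k) + k = m + n" using assms by simp
    ultimately show "m mod n = k" by simp
  next
    assume h: "m mod n = k"
    have "(m + (n - k)) mod n = (k + (n - k)) mod n"
      using h by (metis mod_add_left_eq)
    then show "(m + (n - k)) mod n = 0" using assms by simp
  qed
  ultimately have "Suc a div n = (if m mod n = k then Suc (a div n) else a div n)"
    using div_Suc[of a n] by simp
  then show ?thesis by (auto simp: side_def a_def)
qed

lemma side_pos: "side n m k > 0"
  by (simp add: side_def)

lemma side_ge:
  shows "3 ^ (m div n) \<le> side n m k"
  by (auto simp: side_def intro!: power_increasing div_le_mono)

definition sgn_at :: "nat set \<Rightarrow> nat \<Rightarrow> int" where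
  "sgn_at F k = (if k \<in> F then -1 else 1)"

definition displace :: "nat set \<Rightarrow> (nat \<Rightarrow> nat) \<Rightarrow> cell \<Rightarrow> cell" where
  "displace F a p = map (\<lambda>k. p ! k + sgn_at F k * int (a k)) [0..<length p]"

lemma length_displace [simp]: "length (displace F a p) = length p"
  by (simp add: displace_def)

lemma nth_displace: "k < length p \<Longrightarrow> displace F a p ! k = p ! k + sgn_at F k * int (a k)"
  by (simp add: displace_def)

lemma length_apply_move [simp]: "length (apply_move mv p) = length p"
  by (simp add: apply_move_def)

lemma nth_heading:
  "k < length p \<Longrightarrow> apply_move (heading i F) p ! k = p ! k + (if k = i then sgn_at F k else 0)"
  by (auto simp: apply_move_def heading_def sgn_at_def nth_list_update)

text \<open>By \<open>val3_add\<close> the steps after \<open>k * 3 ^ m\<close> use the same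
  dimensions as the initial ones.\<close>

lemma peano_add:
  assumes "0 < n" "r < 3 ^ m"
  shows "peano n s (k * 3 ^ m + r) = peano n (peano n s (k * 3 ^ m)) r"
  using assms(2)
proof (induction r)
  case (Suc r)
  then show ?case using val3_add[of "Suc r" m k] by simp
qed simp

text \<open>The level-\<open>m+1\<close> path consists of three level-\<open>m\<close> paths joined by two steps in dimension
  \<open>m mod n\<close>; the middle one is reflected in all other dimensions.\<close>

lemma peano_third:
  assumes n: "0 < n"
    and IH: "\<And>F p. F \<subseteq> {..<n} \<Longrightarrow> length p = n \<Longrightarrow>
       peano n (F, p) (3 ^ m - 1) = (F, displace F (\<lambda>k. side n m k - 1) p)"
    and F: "F \<subseteq> {..<n}" and p: "length p = n" and k: "k < 3"
  shows "peano n (F, p) (k * 3 ^ m) =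
     (if k = 1 then flip_others n (m mod n) F else F,
      displace F (\<lambda>l. if l = m mod n then k * side n m l
                       else if k = 1 then side n m l - 1 else 0) p)"
proof -
  define i where "i = m mod n"
  have i: "i < n" using n by (simp add: i_def)
  let ?s = "side n m"
  have pos: "\<And>l. ?s l > 0" by (rule side_pos)
  have adv: "peano n (F, p) (Suc k * 3 ^ m) =
      peano_step n i (peano n (peano n (F, p) (k * 3 ^ m)) (3 ^ m - 1))" if "k < 2" for k
  proof -
    have e: "Suc k * 3 ^ m = Suc (k * 3 ^ m + (3 ^ m - 1))" by simp
    have "peano n (F, p) (Suc k * 3 ^ m) =
       peano_step n (val3 (Suc k * 3 ^ m) mod n) (peano n (F, p) (k * 3 ^ m + (3 ^ m - 1)))"
      by (simp only: e peano.simps)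
    also have "val3 (Suc k * 3 ^ m) = m" by (rule val3_power) (use that in auto)
    also have "peano n (F, p) (k * 3 ^ m + (3 ^ m - 1)) =
        peano n (peano n (F, p) (k * 3 ^ m)) (3 ^ m - 1)"
      by (rule peano_add) (use n in auto)
    finally show ?thesis by (simp add: i_def)
  qed
  let ?G = "flip_others n i F"
  have G: "?G \<subseteq> {..<n}" by (auto simp: flip_others_def)
  have GG: "flip_others n i ?G = F" using F by (auto simp: flip_others_def)
  have sg: "sgn_at ?G l = (if l = i then sgn_at F l else - sgn_at F l)" if "l < n" for l
    using that by (auto simp: flip_others_def sgn_at_def)
  have c0: "peano n (F, p) (0 * 3 ^ m) = (F, displace F (\<lambda>l. 0) p)"
    using p by (auto simp: nth_displace intro!: nth_equalityI)
  have c1: "peano n (F, p) (1 * 3 ^ m) =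
      (?G, displace F (\<lambda>l. if l = i then ?s l else ?s l - 1) p)"
    using adv[of 0] IH[OF F p] p pos
    by (auto simp: peano_step_def nth_displace nth_heading algebra_simps of_nat_diff Suc_le_eq
        intro!: nth_equalityI)
  define q where "q = displace F (\<lambda>l. if l = i then ?s l else ?s l - 1) p"
  have q: "length q = n" by (simp add: q_def p)
  have c2: "peano n (F, p) (2 * 3 ^ m) = (F, displace F (\<lambda>l. if l = i then 2 * ?s l else 0) p)"
  proof -
    have "peano n (F, p) (2 * 3 ^ m) =
       peano_step n i (?G, displace ?G (\<lambda>k. ?s k - 1) q)"
      using adv[of 1] c1 IH[OF G q] by (simp add: q_def numeral_2_eq_2)
    also have "\<dots> = (F, displace F (\<lambda>l. if l = i then 2 * ?s l else 0) p)"
    proof -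
      have "apply_move (heading i ?G) (displace ?G (\<lambda>k. ?s k - 1) q) ! l =
          displace F (\<lambda>l. if l = i then 2 * ?s l else 0) p ! l" if l: "l < n" for l
        using l p q pos[of l]
        by (simp add: nth_heading nth_displace sg q_def of_nat_diff Suc_le_eq algebra_simps)
      then have "apply_move (heading i ?G) (displace ?G (\<lambda>k. ?s k - 1) q) =
          displace F (\<lambda>l. if l = i then 2 * ?s l else 0) p"
        using p q by (intro nth_equalityI) auto
      then show ?thesis by (simp add: peano_step_def GG)
    qed
    finally show ?thesis .
  qed
  consider "k = 0" | "k = 1" | "k = 2" using k by linarith
  then show ?thesis
    by cases (use c0 c1 c2 in \<open>auto simp: i_def cong: if_cong\<close>)
qed

text \<open>With \<open>s\<close> the side at level \<open>m\<close>: in dimension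
  \<open>m mod n\<close> three traversals and two joining steps add up to \<open>3 * s - 1\<close>;
  in the others the reflected middle traversal cancels one, leaving \<open>s - 1\<close>.\<close>

lemma peano_end:
  assumes n: "0 < n"
  shows "F \<subseteq> {..<n} \<Longrightarrow> length p = n \<Longrightarrow>
    peano n (F, p) (3 ^ m - 1) = (F, displace F (\<lambda>k. side n m k - 1) p)"
proof (induction m arbitrary: F p)
  case 0
  then show ?case by (auto simp: side_0 nth_displace intro!: nth_equalityI)
next
  case (Suc m)
  let ?s = "side n m"
  have pos: "\<And>l. ?s l > 0" by (rule side_pos)
  have e: "3 ^ Suc m - 1 = 2 * 3 ^ m + (3 ^ m - 1 :: nat)" by simp
  define q where "q = displace F (\<lambda>l. if l = m mod n then 2 * ?s l else 0) p"
  have q: "length q = n" by (simp add: q_def Suc.prems)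
  have "peano n (F, p) (3 ^ Suc m - 1) = peano n (peano n (F, p) (2 * 3 ^ m)) (3 ^ m - 1)"
    unfolding e by (rule peano_add) (use n in auto)
  also have "\<dots> = peano n (F, q) (3 ^ m - 1)"
    using peano_third[OF n Suc.IH Suc.prems, of 2] by (simp add: q_def cong: if_cong)
  also have "\<dots> = (F, displace F (\<lambda>k. ?s k - 1) q)"
    using Suc.IH[OF Suc.prems(1) q] .
  also have "\<dots> = (F, displace F (\<lambda>k. side n (Suc m) k - 1) p)"
    using pos Suc.prems q
    by (auto simp: q_def nth_displace side_Suc algebra_simps of_nat_diff Suc_le_eq
          intro!: nth_equalityI)
  finally show ?case .
qed

text \<open>The quotient of \<open>a i\<close> by the level-\<open>m\<close> side selects the third
  of the box containing the target; induction finishes inside it.\<close>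

lemma peano_covers:
  assumes n: "0 < n"
  shows "F \<subseteq> {..<n} \<Longrightarrow> length p = n \<Longrightarrow> (\<And>k. k < n \<Longrightarrow> a k < side n m k) \<Longrightarrow>
    \<exists>r<3 ^ m. snd (peano n (F, p) r) = displace F a p"
proof (induction m arbitrary: F p a)
  case 0
  then have "displace F a p = p"
    by (auto simp: side_0 nth_displace intro!: nth_equalityI)
  then show ?case by simp
next
  case (Suc m)
  let ?s = "side n m"
  have pos: "\<And>l. ?s l > 0" by (rule side_pos)
  define i where "i = m mod n"
  have i: "i < n" using n by (simp add: i_def)
  define k where "k = a i div ?s i"
  have "a i < 3 * ?s i" using Suc.prems(3)[OF i] i by (simp add: side_Suc i_def)
  then have k: "k < 3" by (simp add: k_def div_less_iff_less_mult side_pos)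
  define G where "G = (if k = 1 then flip_others n i F else F)"
  define q where "q = displace F (\<lambda>l. if l = i then k * ?s l
                       else if k = 1 then ?s l - 1 else 0) p"
  \<comment> \<open>In the middle third the path starts at the far end of every other dimension, so
    offsets there are measured backwards.\<close>
  define b where "b = (\<lambda>l. if l = i then a l mod ?s l else if k = 1 then ?s l - 1 - a l else a l)"
  have G: "G \<subseteq> {..<n}" using Suc.prems by (auto simp: G_def flip_others_def)
  have q: "length q = n" by (simp add: q_def Suc.prems)
  have al: "a l < ?s l" if "l < n" "l \<noteq> i" for l
    using Suc.prems(3)[OF that(1)] that by (simp add: side_Suc i_def)
  have b: "b l < ?s l" if "l < n" for l
    using al[OF that] pos[of l] by (auto simp: b_def)
  obtain r where r: "r < 3 ^ m" "snd (peano n (G, q) r) = displace G b q"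
    using Suc.IH[OF G q b] by auto
  have "peano n (F, p) (k * 3 ^ m) = (G, q)"
    using peano_third[OF n peano_end[OF n] Suc.prems(1,2) k, of m]
    by (simp add: G_def q_def i_def cong: if_cong)
  then have "snd (peano n (F, p) (k * 3 ^ m + r)) = displace G b q"
    using peano_add[OF n r(1), of "(F, p)" k] r(2) by simp
  also have "\<dots> = displace F a p"
  proof (rule nth_equalityI)
    fix l assume "l < length (displace G b q)"
    then have l: "l < n" by (simp add: q)
    have "sgn_at G l = (if k = 1 \<and> l \<noteq> i then - sgn_at F l else sgn_at F l)"
      using l by (auto simp: G_def flip_others_def sgn_at_def)
    moreover have "int k * int (?s i) + int (a i mod ?s i) = int (a i)"
      unfolding k_def by (metis div_mult_mod_eq of_nat_add of_nat_mult)
    moreover have "sgn_at F l * int (?s l - 1) =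
        sgn_at F l * int (a l) + sgn_at F l * int (?s l - 1 - a l)" if "l \<noteq> i"
      using al[OF l that] by (simp flip: distrib_left of_nat_add)
    ultimately show "displace G b q ! l = displace F a p ! l"
      using l q Suc.prems(2)
      by (auto simp: nth_displace q_def b_def algebra_simps simp flip: distrib_left)
  qed (simp add: q Suc.prems)
  finally have "snd (peano n (F, p) (k * 3 ^ m + r)) = displace F a p" .
  moreover have "k * 3 ^ m + r < 3 ^ Suc m"
  proof -
    have "k * 3 ^ m + r < Suc k * 3 ^ m" using r by simp
    also have "\<dots> \<le> 3 * 3 ^ m" using k by (intro mult_right_mono) auto
    finally show ?thesis by simp
  qed
  ultimately show ?case by blast
qed

section \<open>Exploring all orthants\<close>

type_synonym ctrl = "nat \<times> nat \<times> nat set"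

text \<open>The bits of the counter serve as sign set, so \<open>2 ^ n\<close> successive values run
  through all orthants. The counter is kept apart because \<open>F\<close> changes along the
  path.\<close>

definition next_orthant :: "nat \<Rightarrow> ctrl \<Rightarrow> ctrl" where
  "next_orthant n = (\<lambda>(i, w, F). (i, Suc w mod 2 ^ n, set_decode (Suc w mod 2 ^ n)))"

definition flip_all :: "nat \<Rightarrow> ctrl \<Rightarrow> ctrl" where
  "flip_all n = (\<lambda>(i, w, F). (i, w, {..<n} - F))"

definition turn :: "nat \<Rightarrow> ctrl \<Rightarrow> ctrl" where
  "turn n = (\<lambda>(i, w, F). (i, w, flip_others n i F))"

definition dir :: "ctrl \<Rightarrow> move" where
  "dir = (\<lambda>(i, w, F). heading i F)"

definition set_dim :: "nat \<Rightarrow> ctrl \<Rightarrow> ctrl" where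
  "set_dim i = (\<lambda>(_, w, F). (i, w, F))"

text \<open>From time \<open>3^m\<close> to \<open>2 * 3^m\<close> the tour follows the Peano path of level \<open>m\<close> from the origin;
  with all signs flipped the same path leads back, reaching the origin just before \<open>3^(m+1)\<close>.\<close>

definition tour_step :: "nat \<Rightarrow> nat \<Rightarrow> ctrl \<times> cell \<Rightarrow> ctrl \<times> cell" where
  "tour_step n N = (\<lambda>(g, p). let g' = set_dim (val3 N mod n) g in
     if core3 N = 1 then (next_orthant n g', p)
     else if core3 N = 2 then (flip_all n g', p)
     else (turn n g', apply_move (dir g') p))"

primrec tour :: "nat \<Rightarrow> nat \<Rightarrow> ctrl \<times> cell" where
  "tour n 0 = ((0, 0, {}), replicate n 0)"
| "tour n (Suc N) = tour_step n (Suc N) (tour n N)"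

text \<open>In this range \<open>core3_add\<close> rules out a change of orthant or of all signs,
  and \<open>val3_add\<close> yields the dimensions of a fresh Peano path.\<close>

lemma tour_peano:
  assumes n: "0 < n" and k: "0 < k" and t: "tour n (k * 3 ^ m) = ((i, w, F), p)" and r: "r < 3 ^ m"
  shows "\<exists>i'. tour n (k * 3 ^ m + r) = ((i', w, fst (peano n (F, p) r)), snd (peano n (F, p) r))"
  using r
proof (induction r)
  case 0
  then show ?case by (simp add: t)
next
  case (Suc r)
  then obtain i' where
    IH: "tour n (k * 3 ^ m + r) = ((i', w, fst (peano n (F, p) r)), snd (peano n (F, p) r))"
    by auto
  have "core3 (Suc (k * 3 ^ m + r)) > 2" using core3_add[OF k _ Suc.prems] by simp
  moreover have "val3 (Suc (k * 3 ^ m + r)) = val3 (Suc r)"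
    using val3_add[OF _ Suc.prems] by simp
  ultimately show ?case
    using IH by (auto simp: tour_step_def Let_def set_dim_def turn_def dir_def peano_step_def
        split: prod.splits)
qed

lemma set_decode_subset: "w < 2 ^ n \<Longrightarrow> set_decode w \<subseteq> {..<n}"
proof
  fix k assume w: "w < 2 ^ n" and "k \<in> set_decode w"
  then have "w div 2 ^ k \<noteq> 0" by (metis even_zero mem_Collect_eq set_decode_def)
  then have "2 ^ k \<le> w" by (metis div_less not_le)
  with w have "(2::nat) ^ k < 2 ^ n" by linarith
  then show "k \<in> {..<n}" by simp
qed

lemma displace_back:
  "length p = n \<Longrightarrow> displace ({..<n} - F) a (displace F a p) = p"
  by (auto simp: nth_displace sgn_at_def intro!: nth_equalityI)

text \<open>The outward path ends at the corner opposite the origin with its initial signs; once all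
  signs are complemented, the second copy has the opposite displacement.\<close>

lemma tour_power3:
  assumes n: "0 < n"
  shows "\<exists>i. tour n (3 ^ m) =
    ((i, Suc m mod 2 ^ n, set_decode (Suc m mod 2 ^ n)), replicate n 0)"
proof (induction m)
  case 0
  show ?case using core3_power[of 1 0] n
    by (auto simp: tour_step_def set_dim_def next_orthant_def Let_def)
next
  case (Suc m)
  let ?w = "Suc m mod 2 ^ n" let ?F = "set_decode ?w" let ?O = "replicate n (0::int)"
  have F: "?F \<subseteq> {..<n}" by (rule set_decode_subset) simp
  obtain i where "tour n (1 * 3 ^ m) = ((i, ?w, ?F), ?O)" using Suc by auto
  from tour_peano[OF n _ this, of "3 ^ m - 1"] peano_end[OF n F, of ?O m]
  obtain i where 1: "tour n (1 * 3 ^ m + (3 ^ m - 1)) =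
      ((i, ?w, ?F), displace ?F (\<lambda>k. side n m k - 1) ?O)" by auto
  define q where "q = displace ?F (\<lambda>k. side n m k - 1) ?O"
  have q: "length q = n" by (simp add: q_def)
  have s: "Suc (1 * 3 ^ m + (3 ^ m - 1)) = 2 * 3 ^ m" by simp
  have "tour n (2 * 3 ^ m) =
      tour_step n (2 * 3 ^ m) (tour n (1 * 3 ^ m + (3 ^ m - 1)))"
    unfolding s[symmetric] by (simp only: tour.simps)
  note this[unfolded 1]
  then obtain i where 2: "tour n (2 * 3 ^ m) = ((i, ?w, {..<n} - ?F), q)"
    using core3_power[of 2 m] by (simp add: tour_step_def set_dim_def flip_all_def Let_def q_def)
  from tour_peano[OF n _ 2, of "3 ^ m - 1"] peano_end[OF n _ q, of "{..<n} - ?F" m]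
  obtain i where 3: "tour n (2 * 3 ^ m + (3 ^ m - 1)) = ((i, ?w, {..<n} - ?F), ?O)"
    by (auto simp: displace_back q_def)
  have s: "Suc (2 * 3 ^ m + (3 ^ m - 1)) = 3 ^ Suc m" by simp
  have "tour n (3 ^ Suc m) =
      tour_step n (3 ^ Suc m) (tour n (2 * 3 ^ m + (3 ^ m - 1)))"
    unfolding s[symmetric] by (simp only: tour.simps)
  note this[unfolded 3]
  then show ?case
    using core3_power[of 1 "Suc m"]
    by (simp add: tour_step_def set_dim_def next_orthant_def Let_def mod_Suc_eq)
qed

section \<open>Number of steps until a given cell is visited\<close>

lemma ex_mod_eq:
  fixes M :: nat
  assumes "w < M"
  shows "\<exists>m. a \<le> m \<and> m \<le> a + 2 * M \<and> Suc m mod M = w"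
proof -
  let ?m = "a + (M + w - Suc a mod M)"
  have lt: "Suc a mod M < M" using assms by simp
  have d: "Suc a = Suc a div M * M + Suc a mod M" by simp
  have "Suc (Suc a div M) * M = M + Suc a div M * M" by simp
  then have "Suc ?m = w + Suc (Suc a div M) * M" using lt d by linarith
  then have "Suc ?m mod M = w" using assms by (metis mod_less mod_mult_self1)
  then show ?thesis using assms lt by (intro exI[of _ ?m]) linarith
qed

lemma abs_nth_le_l1: "k < length x \<Longrightarrow> nat \<bar>x ! k\<bar> \<le> l1 x"
proof -
  assume k: "k < length x"
  have "\<bar>x ! k\<bar> = map abs x ! k" using k by simp
  also have "\<dots> \<le> sum_list (map abs x)"
    using k by (intro member_le_sum_list) (auto intro!: bexI[of _ "x ! k"])
  finally show ?thesis by (simp add: l1_def)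
qed

text \<open>The level \<open>m\<close> must be large enough for the box to reach beyond the
  distance, and \<open>Suc m\<close> must lie in the residue class encoding the signs of
  \<open>x\<close>. A window of \<open>2 * 2 ^ n\<close> levels contains such an \<open>m\<close>,
  at the price of a constant factor.\<close>

lemma tour_visits:
  assumes n: "0 < n" and x: "length x = n"
  shows "\<exists>N. snd (tour n N) = x \<and> N \<le> 2 * 3 ^ (n + 2 * 2 ^ n) * Suc (l1 x) ^ n"
proof -
  let ?D = "l1 x"
  obtain k :: nat where k: "?D < 3 ^ k" "3 ^ k \<le> 3 * Suc ?D"
  proof -
    \<comment> \<open>The least exponent keeps \<open>3 ^ k\<close> within a factor 3 of
      \<open>Suc ?D\<close>.\<close>
    define k where "k = (LEAST k. ?D < 3 ^ k)"
    have ex: "?D < 3 ^ ?D" by (rule less_exp[THEN less_le_trans]) (rule power_mono, auto)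
    have "?D < 3 ^ k" unfolding k_def by (rule LeastI[of _ ?D]) (rule ex)
    moreover have "3 ^ k \<le> 3 * Suc ?D"
    proof (cases k)
      case (Suc j)
      then have "\<not> ?D < 3 ^ j" unfolding k_def by (metis lessI not_less_Least)
      then show ?thesis by (simp add: Suc)
    qed simp
    ultimately show ?thesis using that by blast
  qed
  let ?N = "{l. l < n \<and> x ! l < 0}"
  have fin: "finite ?N" by simp
  define w where "w = set_encode ?N"
  have dec: "set_decode w = ?N" by (simp add: w_def set_encode_inverse)
  have "w < 2 ^ n"
  proof -
    have "set_encode ?N \<le> set_encode {..<n}"
      unfolding set_encode_def by (rule sum_mono2) auto
    also have "set_encode {..<n} < 2 ^ n"
      unfolding set_encode_def by (induction n) (auto simp: lessThan_Suc)
    finally show ?thesis by (simp add: w_def)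
  qed
  from ex_mod_eq[OF this, of "n * k"] obtain m
    where m: "n * k \<le> m" "m \<le> n * k + 2 * 2 ^ n" "Suc m mod 2 ^ n = w" by auto
  obtain i where t: "tour n (1 * 3 ^ m) = ((i, w, ?N), replicate n 0)"
    using tour_power3[OF n, of m] m(3) dec by auto
  have "nat \<bar>x ! l\<bar> < side n m l" if "l < n" for l
  proof -
    have "nat \<bar>x ! l\<bar> \<le> ?D" using that x by (simp add: abs_nth_le_l1)
    also have "\<dots> < 3 ^ k" by (rule k)
    also have "\<dots> \<le> 3 ^ (m div n)"
      using m(1) n by (intro power_increasing) (auto simp: less_eq_div_iff_mult_less_eq mult.commute)
    also have "\<dots> \<le> side n m l" by (rule side_ge)
    finally show ?thesis .
  qed
  from peano_covers[OF n _ _ this, of ?N "replicate n 0"] obtain r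
    where r: "r < 3 ^ m"
      "snd (peano n (?N, replicate n 0) r) = displace ?N (\<lambda>l. nat \<bar>x ! l\<bar>) (replicate n 0)" by auto
  have "displace ?N (\<lambda>l. nat \<bar>x ! l\<bar>) (replicate n 0) = x"
    using x by (auto simp: nth_displace sgn_at_def intro!: nth_equalityI)
  with tour_peano[OF n _ t r(1)] r(2) have "snd (tour n (1 * 3 ^ m + r)) = x" by auto
  moreover have "1 * 3 ^ m + r \<le> 2 * 3 ^ (n + 2 * 2 ^ n) * Suc ?D ^ n"
  proof -
    have "1 * 3 ^ m + r \<le> 2 * 3 ^ m" using r by simp
    also have "(3::nat) ^ m \<le> 3 ^ (n * k + 2 * 2 ^ n)"
      using m by (intro power_increasing) auto
    also have "(3::nat) ^ (n * k + 2 * 2 ^ n) = (3 ^ k) ^ n * 3 ^ (2 * 2 ^ n)"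
      by (simp add: power_add mult.commute flip: power_mult)
    also have "\<dots> \<le> (3 * Suc ?D) ^ n * 3 ^ (2 * 2 ^ n)"
      using k(2) by (intro mult_right_mono power_mono) auto
    also have "2 * \<dots> = 2 * 3 ^ (n + 2 * 2 ^ n) * Suc ?D ^ n"
      by (simp only: power_mult_distrib power_add mult_ac)
    finally show ?thesis by simp
  qed
  ultimately show ?thesis by blast
qed

text \<open>The ball contains the cube with coordinates in \<open>{0..D div n}\<close>, and
  \<open>Suc D \<le> n * Suc (D div n)\<close>.\<close>

lemma power_le_ball_card:
  assumes n: "0 < n"
  shows "Suc D ^ n \<le> n ^ n * ball_card n D"
proof -
  define d where "d = D div n"
  let ?B = "{x :: cell. length x = n \<and> l1 x \<le> D}"
  let ?L = "{x :: cell. set x \<subseteq> {0..int d} \<and> length x = n}"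
  have "?B \<subseteq> {x. set x \<subseteq> {- int D..int D} \<and> length x = n}"
  proof -
    have "y \<in> {- int D..int D}" if x: "l1 x \<le> D" "y \<in> set x" for x y
    proof -
      obtain k where "k < length x" "y = x ! k" using x by (metis in_set_conv_nth)
      then have "nat \<bar>y\<bar> \<le> D" using abs_nth_le_l1[of k x] x by simp
      then show ?thesis by auto
    qed
    then show ?thesis by blast
  qed
  then have fin: "finite ?B" by (rule finite_subset) (rule finite_lists_length_eq, simp)
  have "?L \<subseteq> ?B"
  proof -
    have "l1 x \<le> D" if x: "set x \<subseteq> {0..int d}" and l: "length x = n" for x :: cell
    proof -
    have "sum_list (map abs x) \<le> int d * int (length x)"
      using x by (induction x) (auto simp: algebra_simps)
    then have "l1 x \<le> d * n" using l by (simp add: l1_def nat_le_iff)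
    also have "\<dots> \<le> D" by (simp add: d_def)
    finally show ?thesis .
    qed
    then show ?thesis by blast
  qed
  then have "card ?L \<le> ball_card n D" unfolding ball_card_def using fin by (rule card_mono[rotated])
  moreover have "card ?L = Suc d ^ n" by (subst card_lists_length_eq) (auto simp: nat_add_distrib)
  ultimately have "Suc d ^ n \<le> ball_card n D" by simp
  moreover have "Suc D \<le> n * Suc d"
    unfolding d_def using n by (metis Suc_leI dividend_less_times_div mult_Suc_right add.commute)
  then have "Suc D ^ n \<le> n ^ n * Suc d ^ n"
    by (metis power_mono power_mult_distrib zero_le)
  ultimately show ?thesis by (meson le_trans mult_le_mono2)
qed

section \<open>The agents\<close>

text \<open>Agent 0 is the controller \<open>C\<close>, agents 1 to 4 are the passive \<open>B\<close>, \<open>X\<close>, \<open>Y\<close>, \<open>Z\<close>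
  (\<open>Z\<close> occurs only in the semi-synchronous model). The labels \<open>RunL\<close>, \<open>RunR\<close> serve the
  synchronous division by 3, those from \<open>Half0\<close> to \<open>Back\<close> the semi-synchronous one. The control
  data \<open>(i, w, F)\<close> are the current dimension, the number of the current orthant, and the set of
  dimensions in which the walk currently runs backwards.\<close>

datatype label =
    Top | TopY | TopC | Divide | RunL nat | RunR nat
  | Half0 | Half0Z | Half0C | Half1 | Half1W | Half1X | Half1C | Half2 | Half2X | Half2C | Half2W
  | Home nat | HomeZ nat | HomeC nat | Back nat
  | Rest nat | Unit nat | Carry nat | CarryX nat | CarryC nat
  | ShiftX | ShiftY | SeekB | ShiftB | ShiftZ | ShiftC | SeekX

type_synonym pc = "label \<times> ctrl"

text \<open>\<open>Cmd k mv pc\<close> makes agent \<open>k\<close> perform \<open>mv\<close>; the controller continues at \<open>pc\<close> once it no longer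
  sees \<open>k\<close>, so the command is skipped if \<open>k\<close> is absent. \<open>If k a b\<close> branches on the presence
  of agent \<open>k\<close>.\<close>

datatype instr = Cmd nat move pc | If nat "move \<times> pc" "move \<times> pc"

abbreviation stay :: move where "stay \<equiv> (1, 0)"
abbreviation left :: move where "left \<equiv> (-1, 1)"
abbreviation right :: move where "right \<equiv> (1, 1)"

text \<open>A round starts in \<open>Top\<close> with \<open>C\<close>, \<open>X\<close>,
  \<open>Y\<close> together. The first three labels raise the stored number by 1.
  \<open>Divide\<close> to \<open>Rest\<close> divide the distance from \<open>X\<close> to
  \<open>B\<close> by 3, rounding up, until the remainder \<open>r\<close> is nonzero; each
  remainder 0 advances the dimension. In \<open>Unit\<close> the controller is one cell left of
  \<open>X\<close> and sees \<open>B\<close> iff the rounded quotient is 1, so that the core is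
  \<open>r\<close>. \<open>Carry\<close> takes \<open>X\<close> back to \<open>Y\<close>; then
  either only signs change, or \<open>ShiftX\<close> to \<open>SeekX\<close> move the whole line by
  one cell. An \<open>If 1\<close> with equal branches is an unconditional action of the
  controller.\<close>

fun code :: "nat \<Rightarrow> bool \<Rightarrow> label \<Rightarrow> ctrl \<Rightarrow> instr" where
  "code n sy Top g = Cmd 2 right (TopY, g)"
| "code n sy TopY g = Cmd 3 right (TopC, g)"
| "code n sy TopC g = If 1 (right, Divide, set_dim 0 g) (right, Divide, set_dim 0 g)"
| "code n sy Divide g = (if sy then If 1 (stay, RunL 0, g) (stay, RunL 0, g)
     else If 1 (stay, Half0, g) (left, Divide, g))"
| "code n sy (RunL j) g = (if j < 2 then If 1 (right, RunR (Suc j), g) (left, RunL (Suc j), g)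
     else If 1 (stay, RunL 0, g) (stay, RunL 0, g))"
| "code n sy (RunR j) g = If 2 (stay, Rest (2 * j mod 3), g)
     (if j < 2 then (right, RunR (Suc j), g) else (stay, RunR 0, g))"
| "code n sy Half0 g = If 2 (stay, Home 0, g) (stay, Half0Z, g)"
| "code n sy Half0Z g = Cmd 4 right (Half0C, g)"
| "code n sy Half0C g = If 1 (right, Half1, g) (right, Half1, g)"
| "code n sy Half1 g = If 2 (stay, Home 1, g) (stay, Half1W, g)"
| "code n sy Half1W g = If 2 (stay, Half1X, g) (right, Half1W, g)"
| "code n sy Half1X g = Cmd 2 left (Half1C, g)"
| "code n sy Half1C g = If 1 (left, Half2, g) (left, Half2, g)"
| "code n sy Half2 g = If 4 (stay, Home 2, g) (stay, Half2X, g)"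
| "code n sy Half2X g = Cmd 2 left (Half2C, g)"
| "code n sy Half2C g = If 1 (left, Half2W, g) (left, Half2W, g)"
| "code n sy Half2W g = If 4 (stay, Half0, g) (left, Half2W, g)"
| "code n sy (Home r) g = If 1 (stay, Back r, g) (stay, HomeZ r, g)"
| "code n sy (HomeZ r) g = Cmd 4 left (HomeC r, g)"
| "code n sy (HomeC r) g = If 1 (left, Home r, g) (left, Home r, g)"
| "code n sy (Back r) g = If 2 (stay, Rest r, g) (right, Back r, g)"
| "code n sy (Rest r) g = (if r = 0
     then If 1 (stay, Divide, set_dim (Suc (fst g) mod n) g) (stay, Divide, set_dim (Suc (fst g) mod n) g)
     else If 1 (left, Unit r, g) (left, Unit r, g))"
| "code n sy (Unit r) g = If 1 (right, Carry r, g) (right, Carry 0, g)"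
| "code n sy (Carry u) g = If 3
     (stay, if u = 1 then (Top, next_orthant n g) else if u = 2 then (Top, flip_all n g) else (ShiftX, g))
     (stay, CarryX u, g)"
| "code n sy (CarryX u) g = Cmd 2 right (CarryC u, g)"
| "code n sy (CarryC u) g = If 1 (right, Carry u, g) (right, Carry u, g)"
| "code n sy ShiftX g = Cmd 2 (dir g) (ShiftY, g)"
| "code n sy ShiftY g = Cmd 3 (dir g) (SeekB, g)"
| "code n sy SeekB g = If 1 (stay, ShiftB, g) (left, SeekB, g)"
| "code n sy ShiftB g = Cmd 1 (dir g) (ShiftZ, g)"
| "code n sy ShiftZ g = Cmd 4 (dir g) (ShiftC, g)"
| "code n sy ShiftC g = If 1 (dir g, SeekX, turn n g) (dir g, SeekX, turn n g)"
| "code n sy SeekX g = If 2 (stay, Top, g) (right, SeekX, g)"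

text \<open>In \<open>Pas k r\<close>, \<open>r\<close> is 0 for an idle agent; otherwise it is one plus the phase of the clock of a
  running \<open>X\<close>.\<close>

datatype state = Ctl pc | Pas nat nat

section \<open>Transition function and configurations\<close>

definition present :: "nat \<Rightarrow> state set \<Rightarrow> bool" where
  "present k O' \<longleftrightarrow> (\<exists>r. Pas k r \<in> O')"

text \<open>The synchronous \<open>X\<close> starts its clock in the very tick in which the
  controller passes from \<open>Divide\<close> to \<open>RunL 0\<close>; this puts both clocks in
  phase.\<close>

fun react :: "nat \<Rightarrow> bool \<Rightarrow> nat \<Rightarrow> pc \<Rightarrow> state \<times> move" where
  "react n sy k (l, g) = (if sy \<and> k = 2 \<and> l = Divide then (Pas k 1, stay)
     else case code n sy l g of Cmd k' mv _ \<Rightarrow> (Pas k 0, if k' = k then mv else stay)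
       | If _ _ _ \<Rightarrow> (Pas k 0, stay))"

text \<open>In the configurations that occur there is one controller, so \<open>SOME\<close> picks
  its state. A running \<open>X\<close> stops only at a returning controller, hence not on their
  common starting cell.\<close>

fun delta :: "nat \<Rightarrow> bool \<Rightarrow> state \<Rightarrow> state set \<Rightarrow> state \<times> move" where
  "delta n sy (Ctl (l, g)) O' = (case code n sy l g of
       Cmd k mv pc \<Rightarrow> (if present k O' then Ctl (l, g) else Ctl pc, stay)
     | If k a b \<Rightarrow> (let (mv, pc) = (if present k O' then a else b) in (Ctl pc, mv)))"
| "delta n sy (Pas k r) O' =
     (if r = 0 then (if \<exists>pc. Ctl pc \<in> O' then react n sy k (SOME pc. Ctl pc \<in> O') else (Pas k 0, stay))
      else if \<exists>j g. Ctl (RunR j, g) \<in> O' then (Pas k 0, stay)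
      else if r < 3 then (Pas k (Suc r), stay) else (Pas k 1, left))"

definition cfg :: "label \<Rightarrow> ctrl \<Rightarrow> nat \<Rightarrow> (nat \<Rightarrow> cell) \<Rightarrow> state config" where
  "cfg l g r f = (\<lambda>k. (if k = 0 then Ctl (l, g) else Pas k (if k = 2 then r else 0), f k))"

text \<open>Runs carry unspecified values \<open>init ! k\<close> at indices beyond the agents, so
  only the first \<open>m\<close> are compared.\<close>

definition agr :: "nat \<Rightarrow> 'q config \<Rightarrow> 'q config \<Rightarrow> bool" where
  "agr m c d \<longleftrightarrow> (\<forall>k<m. c k = d k)"

lemma agr_refl [simp]: "agr m c c"
  by (simp add: agr_def)

lemma agr_trans: "agr m c d \<Longrightarrow> agr m d e \<Longrightarrow> agr m c e"
  by (simp add: agr_def)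

lemma agr_observe: "agr m c d \<Longrightarrow> k < m \<Longrightarrow> observe m c k = observe m d k"
  unfolding agr_def observe_def by (intro Collect_cong ex_cong1) auto

lemma agr_step: "agr m c d \<Longrightarrow> agr m (step \<delta> m A c) (step \<delta> m A d)"
proof -
  assume h: "agr m c d"
  then have "c k = d k" if "k < m" for k using that by (simp add: agr_def)
  then show ?thesis by (simp add: agr_def step_def agr_observe[OF h])
qed

lemma cfg_apply:
  "cfg l g r f k = (if k = 0 then Ctl (l, g) else Pas k (if k = 2 then r else 0), f k)"
  by (simp add: cfg_def)

section \<open>Reachability within a bounded number of ticks\<close>

locale machine =
  fixes n m :: nat
  assumes n_pos: "0 < n" and m_cases: "m = 4 \<or> m = 5"
begin

definition sync :: bool where "sync \<longleftrightarrow> m = 4"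

definition tick :: "state config \<Rightarrow> state config" where
  "tick = step (delta n sync) m {..<m}"

text \<open>Quantifying over all \<open>c'\<close> that agree with \<open>c\<close> makes the
  relation compose although targets are known only up to \<open>agr\<close>.\<close>

definition lead :: "nat \<Rightarrow> state config \<Rightarrow> state config \<Rightarrow> bool" where
  "lead b c d \<longleftrightarrow> (\<forall>c'. agr m c' c \<longrightarrow> (\<exists>t\<le>b. agr m ((tick ^^ t) c') d))"

lemma lead_agr: "agr m c d \<Longrightarrow> lead b c d"
  unfolding lead_def by (metis agr_trans funpow_0 zero_le)

lemma lead_refl [simp]: "lead b c c"
  by (simp add: lead_agr)

lemma lead_trans: "lead b1 c d \<Longrightarrow> lead b2 d e \<Longrightarrow> b1 + b2 \<le> b \<Longrightarrow> lead b c e"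
proof -
  assume 1: "lead b1 c d" and 2: "lead b2 d e" and b: "b1 + b2 \<le> b"
  show ?thesis unfolding lead_def
  proof (intro allI impI)
    fix c' assume "agr m c' c"
    then obtain t where t: "t \<le> b1" "agr m ((tick ^^ t) c') d" using 1 by (auto simp: lead_def)
    then obtain t' where t': "t' \<le> b2" "agr m ((tick ^^ t') ((tick ^^ t) c')) e"
      using 2 by (auto simp: lead_def)
    then show "\<exists>t\<le>b. agr m ((tick ^^ t) c') e"
      using t b by (intro exI[of _ "t' + t"]) (auto simp: funpow_add)
  qed
qed

lemma lead_mono: "lead b c d \<Longrightarrow> b \<le> b' \<Longrightarrow> lead b' c d"
  by (rule lead_trans[OF _ lead_refl[of 0]]) auto

lemma lead_tick: "agr m (tick c) d \<Longrightarrow> lead 1 c d"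
  unfolding lead_def
  by (intro allI impI exI[of _ 1]) (auto simp: tick_def intro: agr_trans[OF agr_step])

lemma present_observe [simp]:
  "k < m \<Longrightarrow> present j (observe m (cfg l g r f) k) \<longleftrightarrow> 0 < j \<and> j < m \<and> f j = f k"
  by (auto simp: present_def observe_def cfg_def)

lemma Ctl_observe [simp]:
  "k < m \<Longrightarrow> Ctl pc \<in> observe m (cfg l g r f) k \<longleftrightarrow> pc = (l, g) \<and> f 0 = f k"
  by (auto simp: observe_def cfg_def)

lemma m_gt: "j < 4 \<Longrightarrow> j < m"
  using m_cases by auto

lemma tick_apply: "k < m \<Longrightarrow> tick c k =
    (fst (delta n sync (fst (c k)) (observe m c k)),
     apply_move (snd (delta n sync (fst (c k)) (observe m c k))) (snd (c k)))"
  by (simp add: tick_def step_def)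

lemma apply_stay [simp]: "apply_move (s, 0) p = p"
  by (simp add: apply_move_def)

lemma tick_0:
  "tick (cfg l g r f) 0 = (case code n sync l g of
       Cmd j mv pc \<Rightarrow> (if 0 < j \<and> j < m \<and> f j = f 0 then Ctl (l, g) else Ctl pc, f 0)
     | If j a b \<Rightarrow> let s = if 0 < j \<and> j < m \<and> f j = f 0 then a else b in
          (Ctl (snd s), apply_move (fst s) (f 0)))"
  using m_gt[of 0] by (simp add: tick_apply cfg_apply Let_def split: prod.splits instr.splits)

lemma delta_idle:
  assumes "k < m"
  shows "delta n sync (Pas k 0) (observe m (cfg l g r f) k) =
    (if f 0 = f k then react n sync k (l, g) else (Pas k 0, stay))"
proof -
  have "(\<exists>pc. Ctl pc \<in> observe m (cfg l g r f) k) \<longleftrightarrow> f 0 = f k" using assms by auto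
  moreover have "(SOME pc. Ctl pc \<in> observe m (cfg l g r f) k) = (l, g)" if "f 0 = f k"
    by (rule some_equality) (use assms that in auto)
  ultimately show ?thesis by (simp del: react.simps split_paired_Ex)
qed

lemma tick_idle:
  assumes "0 < k" "k < m" "k = 2 \<longrightarrow> r = 0"
  shows "tick (cfg l g r f) k = (if f 0 = f k
     then (fst (react n sync k (l, g)), apply_move (snd (react n sync k (l, g))) (f k))
     else (Pas k 0, f k))"
  using assms by (auto simp: tick_apply cfg_apply delta_idle simp del: react.simps delta.simps)

lemma tick_running:
  assumes "0 < r" 
  shows "tick (cfg l g r f) 2 = (if (\<exists>j. l = RunR j) \<and> f 2 = f 0 then (Pas 2 0, f 2)
      else if r < 3 then (Pas 2 (Suc r), f 2) else (Pas 2 1, apply_move left (f 2)))"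
  using assms m_gt[of 2] by (auto simp: tick_apply cfg_apply)

lemma tick_If:
  assumes "code n sync l g = If j a b" "0 < j" "\<not> (sync \<and> l = Divide)"
    "s = (if j < m \<and> f j = f 0 then a else b)"
  shows "agr m (tick (cfg l g 0 f))
    (cfg (fst (snd s)) (snd (snd s)) 0 (f(0 := apply_move (fst s) (f 0))))"
  unfolding agr_def
proof (intro allI impI)
  fix k assume k: "k < m"
  show "tick (cfg l g 0 f) k =
    cfg (fst (snd s)) (snd (snd s)) 0 (f(0 := apply_move (fst s) (f 0))) k"
    using assms k by (cases "k = 0") (auto simp: tick_0 tick_idle cfg_apply Let_def)
qed

lemma tick_Cmd:
  assumes "code n sync l g = Cmd j mv pc" "0 < j" "\<not> (sync \<and> l = Divide)"
  shows "agr m (tick (cfg l g 0 f)) (if j < m \<and> f j = f 0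
    then cfg l g 0 (f(j := apply_move mv (f j))) else cfg (fst pc) (snd pc) 0 f)"
  unfolding agr_def
proof (intro allI impI)
  fix k assume k: "k < m"
  show "tick (cfg l g 0 f) k = (if j < m \<and> f j = f 0
    then cfg l g 0 (f(j := apply_move mv (f j))) else cfg (fst pc) (snd pc) 0 f) k"
    using assms k by (cases "k = 0") (auto simp: tick_0 tick_idle cfg_apply)
qed

lemma code_Cmd:
  "code n sync l g = Cmd j mv pc \<Longrightarrow>
    0 < j \<and> (j < m \<or> j = 4) \<and> (mv = left \<or> mv = right \<or> mv = dir g)"
  by (cases l) (use m_cases in \<open>auto split: if_splits\<close>)

lemma code_If: "code n sync l g = If j a b \<Longrightarrow> 0 < j"
  by (cases l) (auto split: if_splits)


text \<open>A command moves agent \<open>j\<close> even if \<open>j \<ge> m\<close>: with four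
  agents a fictitious \<open>Z\<close> is moved along, invisible to \<open>agr\<close>, and both
  models share the same bookkeeping.\<close>

definition exec :: "label \<Rightarrow> ctrl \<Rightarrow> (nat \<Rightarrow> cell) \<Rightarrow> state config" where
  "exec l g f = (case code n sync l g of
       Cmd j mv pc \<Rightarrow> cfg (fst pc) (snd pc) 0 (if f j = f 0 then f(j := apply_move mv (f j)) else f)
     | If j a b \<Rightarrow> let s = if j < m \<and> f j = f 0 then a else b in
         cfg (fst (snd s)) (snd (snd s)) 0 (f(0 := apply_move (fst s) (f 0))))"

lemma apply_move_neq: "fst mv \<noteq> 0 \<Longrightarrow> 0 < snd mv \<Longrightarrow> snd mv \<le> length p \<Longrightarrow> apply_move mv p \<noteq> p"
proof
  assume mv: "fst mv \<noteq> 0" "0 < snd mv" "snd mv \<le> length p" and "apply_move mv p = p"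
  then have "apply_move mv p ! (snd mv - 1) = p ! (snd mv - 1)" by simp
  with mv show False by (simp add: apply_move_def)
qed

text \<open>An executed command takes one tick to move the agent off the cell and one for the
  controller to notice; anything else takes one. Excluded is the synchronous \<open>Divide\<close>,
  where \<open>X\<close> may start its clock.\<close>

lemma lead_exec:
  assumes "\<not> (sync \<and> l = Divide)" "fst g < n" "\<forall>j. length (f j) = n" "2 \<le> b"
    "lead (b - 2) (exec l g f) d"
  shows "lead b (cfg l g 0 f) d"
proof -
  have "lead 2 (cfg l g 0 f) (exec l g f)"
  proof (cases "code n sync l g")
    case (If j a b)
    then show ?thesis using tick_If[OF If code_If[OF If] assms(1) refl, of f]
      by (auto simp: exec_def Let_def intro: lead_mono[OF lead_tick])
  next
    case (Cmd j mv pc)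
    note c = code_Cmd[OF Cmd] and t = tick_Cmd[OF Cmd _ assms(1)]
    let ?f = "f(j := apply_move mv (f j))"
    consider "j < m" "f j = f 0" | "\<not> j < m" | "f j \<noteq> f 0" by blast
    then show ?thesis
    proof cases
      case 1
      have "snd mv \<le> length (f j)" "0 < snd mv" "fst mv \<noteq> 0"
        using c assms(2,3) n_pos by (auto simp: dir_def heading_def split: prod.splits if_splits)
      then have "?f j \<noteq> ?f 0" using apply_move_neq c 1 by auto
      then have "lead 1 (cfg l g 0 ?f) (cfg (fst pc) (snd pc) 0 ?f)"
        using t[of ?f] c by (intro lead_tick) auto
      moreover have "lead 1 (cfg l g 0 f) (cfg l g 0 ?f)"
        using t[of f] c 1 by (intro lead_tick) auto
      ultimately show ?thesis using Cmd 1 by (auto simp: exec_def elim: lead_trans)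
    next
      case 2
      then have "agr m (cfg (fst pc) (snd pc) 0 f) (exec l g f)" using Cmd c
        by (auto simp: exec_def agr_def cfg_apply)
      then show ?thesis using 2 t[of f] c
        by (intro lead_mono[OF lead_tick]) (auto intro: agr_trans)
    next
      case 3
      then show ?thesis using t[of f] c Cmd
        by (intro lead_mono[OF lead_tick]) (auto simp: exec_def)
    qed
  qed
  then show ?thesis using assms by (auto elim: lead_trans)
qed

section \<open>Configurations on a line parallel to the first axis\<close>

definition off :: "cell \<Rightarrow> nat \<Rightarrow> cell" where
  "off p x = p[0 := p ! 0 + int x]"

lemma length_off [simp]: "length (off p x) = length p"
  by (simp add: off_def)

lemma off_0 [simp]: "off p 0 = p"
  by (simp add: off_def)

lemma off_inj [simp]: "length p = n \<Longrightarrow> off p x = off p y \<longleftrightarrow> x = y"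
proof -
  assume "length p = n"
  then have "off p x ! 0 = p ! 0 + int x" for x using n_pos by (simp add: off_def)
  then show ?thesis by (metis add_left_cancel of_nat_eq_iff)
qed

lemma off_off [simp]: "length p = n \<Longrightarrow> off (off p x) y = off p (x + y)"
  using n_pos by (simp add: off_def algebra_simps)

lemma off_eq_self [simp]: "length p = n \<Longrightarrow> off p x = p \<longleftrightarrow> x = 0" "length p = n \<Longrightarrow> p = off p x \<longleftrightarrow> x = 0"
  using off_inj[of p x 0] off_inj[of p 0 x] by auto

lemma right_off [simp]: "length p = n \<Longrightarrow> apply_move right (off p x) = off p (Suc x)"
  using n_pos by (auto simp: off_def apply_move_def algebra_simps)

lemma right_self [simp]: "length p = n \<Longrightarrow> apply_move right p = off p 1"
  using right_off[of p 0] by simp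

lemma left_off [simp]: "length p = n \<Longrightarrow> 0 < x \<Longrightarrow> apply_move left (off p x) = off p (x - 1)"
  using n_pos by (auto simp: off_def apply_move_def algebra_simps)

lemma apply_move_off [simp]:
  "length p = n \<Longrightarrow> fst g < n \<Longrightarrow> apply_move (dir g) (off p x) = off (apply_move (dir g) p) x"
  using n_pos by (cases "fst g = 0")
   (auto simp: off_def apply_move_def dir_def heading_def list_update_swap algebra_simps split: prod.splits)

lemmas off_moves [simp] = right_off[unfolded One_nat_def] right_self[unfolded One_nat_def]
  left_off[unfolded One_nat_def]

definition five :: "cell \<Rightarrow> cell \<Rightarrow> cell \<Rightarrow> cell \<Rightarrow> cell \<Rightarrow> nat \<Rightarrow> cell" where
  "five c b x y z = (\<lambda>k. if k = 0 then c else if k = 1 then b else if k = 2 then x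
     else if k = 3 then y else if k = 4 then z else replicate n 0)"

lemma five_simps [simp]:
  "five c b x y z 0 = c" "five c b x y z (Suc 0) = b" "five c b x y z 2 = x"
  "five c b x y z 3 = y" "five c b x y z 4 = z"
  by (simp_all add: five_def)

lemma five_update [simp]:
  "(five c b x y z)(0 := q) = five q b x y z"
  "(five c b x y z)(Suc 0 := q) = five c q x y z"
  "(five c b x y z)(2 := q) = five c b q y z"
  "(five c b x y z)(3 := q) = five c b x q z"
  "(five c b x y z)(4 := q) = five c b x y q"
  unfolding five_def fun_upd_def by (rule ext; simp)+ 

lemma length_five [simp]:
  "length c = n \<Longrightarrow> length b = n \<Longrightarrow> length x = n \<Longrightarrow> length y = n \<Longrightarrow> length z = n \<Longrightarrow>
    \<forall>j. length (five c b x y z j) = n"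
  by (simp add: five_def)

abbreviation K where "K l g c b x y z \<equiv> cfg l g 0 (five c b x y z)"

lemma m_simps [simp]: "0 < m" "Suc 0 < m" "2 < m" "3 < m" "4 < m \<longleftrightarrow> \<not> sync"
  using m_cases by (auto simp: sync_def)

lemma agr_sync: "sync \<Longrightarrow> agr m c d \<longleftrightarrow> c 0 = d 0 \<and> c 1 = d 1 \<and> c 2 = d 2 \<and> c 3 = d 3"
  by (auto simp: sync_def agr_def numeral_eq_Suc less_Suc_eq)

text \<open>Each cell of the walk is budgeted two ticks, and so is the final branch on seeing agent
  \<open>j\<close>.\<close>

lemma lead_seek_left:
  assumes "code n sync l g = If j (stay, l', g') (left, l, g)"
    and l: "\<not> (sync \<and> l = Divide)" "fst g < n" and p: "length p = n" and j: "0 < j" "j < m" "f j = off p w"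
    and f: "\<forall>j. length (f j) = n"
  shows "lead (2 * d + 2) (cfg l g 0 (f(0 := off p (w + d)))) (cfg l' g' 0 (f(0 := off p w)))"
proof -
  define F where "F v = f(0 := off p v)" for v
  have [simp]: "F v 0 = off p v" "F v j = off p w" "(F v)(0 := off p v') = F v'" "\<forall>j. length (F v j) = n"
    for v v' using assms by (simp_all add: F_def)
  have "lead (2 * d + 2) (cfg l g 0 (F (w + d))) (cfg l' g' 0 (F w))"
    by (induction d; rule lead_exec) (use assms in \<open>simp_all add: exec_def Let_def\<close>)
  then show ?thesis by (simp only: F_def)
qed

lemma lead_seek_right:
  assumes "code n sync l g = If j (stay, l', g') (right, l, g)"
    and l: "\<not> (sync \<and> l = Divide)" "fst g < n" and p: "length p = n" and j: "0 < j" "j < m" "f j = off p (w + d)"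
    and f: "\<forall>j. length (f j) = n"
  shows "lead (2 * d + 2) (cfg l g 0 (f(0 := off p w))) (cfg l' g' 0 (f(0 := off p (w + d))))"
proof -
  define F where "F v = f(0 := off p v)" for v
  have [simp]: "F v 0 = off p v" "F v j = off p (w + d)" "(F v)(0 := off p v') = F v'" "\<forall>j. length (F v j) = n"
    for v v' using assms by (simp_all add: F_def)
  have "v + k = w + d \<Longrightarrow> lead (2 * k + 2) (cfg l g 0 (F v)) (cfg l' g' 0 (F (w + d)))" for k v
  proof (induction k arbitrary: v)
    case 0
    show ?case by (rule lead_exec) (use assms 0 in \<open>simp_all add: exec_def Let_def\<close>)
  next
    case (Suc k)
    show ?case by (rule lead_exec) (use assms Suc in \<open>simp_all add: exec_def Let_def\<close>)
  qed
  then show ?thesis by (simp only: F_def)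
qed

text \<open>Dovetailing \<open>Z\<close> (one cell right) with \<open>X\<close> (two cells left) makes them meet after a third
  of the gap; the point of the cycle at which they meet is the remainder.\<close>

lemma lead_halves:
  assumes sync: "\<not> sync" and g: "fst g < n" and p: "length p = n" and y: "length y = n"
  shows "lead (8 * Suc d * Suc d) (K Half0 g (off p w) p (off p (w + d)) y (off p w))
    (K (Home (d mod 3)) g (off p (w + (d + 2) div 3)) p (off p (w + (d + 2) div 3)) y
       (off p (w + (d + 2) div 3)))"
proof (induction d arbitrary: w rule: less_induct)
  case (less d)
  note [simp] = exec_def Let_def sync g p y
  consider "d = 0" | "d = 1" | "d = 2" | "3 \<le> d" by linarith
  then show ?case
  proof cases
    case 1
    then show ?thesis by (intro lead_exec) auto
  next
    case 2
    have "lead 10 (K Half0 g (off p w) p (off p (Suc w)) y (off p w))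
      (K (Home 1) g (off p (Suc w)) p (off p (Suc w)) y (off p (Suc w)))"
      by (rule lead_exec; simp)+
    then show ?thesis using 2 by (auto elim: lead_mono)
  next
    case 3
    have "lead 18 (K Half0 g (off p w) p (off p (Suc (Suc w))) y (off p w))
      (K (Home 2) g (off p (Suc w)) p (off p (Suc w)) y (off p (Suc w)))"
      by (rule lead_exec; simp)+
    then show ?thesis using 3 by (auto elim: lead_mono)
  next
    case 4
    then obtain e where d: "d = 3 + e" by (metis le_add_diff_inverse)
    let ?w = "Suc w"
    let ?K = "\<lambda>l c x. K l g (off p c) p (off p x) y (off p ?w)"
    let ?x = "Suc (Suc (Suc (w + e)))"
    have 1: "lead 8 (K Half0 g (off p w) p (off p ?x) y (off p w)) (?K Half1W ?w ?x)"
      by (rule lead_exec; simp)+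
    have 2: "lead (2 * (2 + e) + 2) (?K Half1W ?w ?x) (?K Half1X ?x ?x)"
      using lead_seek_right[of Half1W g 2 Half1X g p "five (off p ?w) p (off p ?x) y (off p ?w)" ?w "2 + e"]
      by simp
    have 3: "lead 10 (?K Half1X ?x ?x) (?K Half2W (Suc (w + e)) (Suc (w + e)))"
      by (rule lead_exec; simp)+
    have 4: "lead (2 * e + 2) (?K Half2W (Suc (w + e)) (Suc (w + e))) (?K Half0 ?w (?w + e))"
      using lead_seek_left[of Half2W g 4 Half0 g p "five (off p ?w) p (off p (?w + e)) y (off p ?w)" ?w e]
      by simp
    have 5: "lead (8 * Suc e * Suc e) (?K Half0 ?w (?w + e))
      (K (Home (d mod 3)) g (off p (w + (d + 2) div 3)) p (off p (w + (d + 2) div 3)) y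
       (off p (w + (d + 2) div 3)))"
    proof -
      have "(5 + e) div 3 = Suc (Suc (Suc e) div 3)" by presburger
      then show ?thesis using less.IH[of e ?w] by (simp add: d)
    qed
    have x: "w + d = ?x" by (simp add: d)
    \<comment> \<open>A full round costs at most \<open>4 * e + 26\<close> ticks, less than the
      growth \<open>48 * e + 120\<close> of the bound from gap \<open>e\<close> to gap
      \<open>3 + e\<close>.\<close>
    show ?thesis unfolding x
      by (rule lead_trans[OF 1 lead_trans[OF 2 lead_trans[OF 3 lead_trans[OF 4 5 le_refl] le_refl] le_refl]])
        (simp add: d algebra_simps)
  qed
qed

lemma lead_home:
  assumes sync: "\<not> sync" and g: "fst g < n" and p: "length p = n" and y: "length y = n"
    and x: "length x = n"
  shows "lead (6 * w + 2) (K (Home r) g (off p w) p x y (off p w)) (K (Back r) g p p x y p)"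
proof (induction w)
  case 0
  show ?case using assms by (intro lead_exec) (simp_all add: exec_def Let_def)
next
  case (Suc w)
  have "lead 6 (K (Home r) g (off p (Suc w)) p x y (off p (Suc w))) (K (Home r) g (off p w) p x y (off p w))"
    using assms by - (rule lead_exec; simp add: exec_def Let_def)+
  from lead_trans[OF this Suc] show ?case by simp
qed

text \<open>The controller walks to \<open>B\<close>, makes \<open>X\<close> and \<open>Z\<close>
  meet, brings \<open>Z\<close> home and returns to \<open>X\<close>. Only the meeting has a
  quadratic bound.\<close>

lemma lead_divide_semi:
  assumes sync: "\<not> sync" and g: "fst g < n" and p: "length p = n" and y: "length y = n" and x: "0 < x"
  shows "lead (60 * x * x) (K Divide g (off p x) p (off p x) y p)
    (K (Rest (x mod 3)) g (off p ((x + 2) div 3)) p (off p ((x + 2) div 3)) y p)"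
proof -
  note [simp] = sync g p y
  let ?q = "(x + 2) div 3"
  have 1: "lead (2 * x + 2) (K Divide g (off p x) p (off p x) y p) (K Half0 g p p (off p x) y p)"
    using lead_seek_left[of Divide g 1 Half0 g p "five p p (off p x) y p" 0 x] by simp
  have 2: "lead (8 * Suc x * Suc x) (K Half0 g p p (off p x) y p)
     (K (Home (x mod 3)) g (off p ?q) p (off p ?q) y (off p ?q))"
    using lead_halves[OF sync g p y, of x 0] by simp
  have 3: "lead (6 * ?q + 2) (K (Home (x mod 3)) g (off p ?q) p (off p ?q) y (off p ?q))
     (K (Back (x mod 3)) g p p (off p ?q) y p)"
    by (rule lead_home) auto
  have 4: "lead (2 * ?q + 2) (K (Back (x mod 3)) g p p (off p ?q) y p)
     (K (Rest (x mod 3)) g (off p ?q) p (off p ?q) y p)"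
    using lead_seek_right[of "Back (x mod 3)" g 2 "Rest (x mod 3)" g p "five p p (off p ?q) y p" 0 ?q]
    by simp
  have q: "?q \<le> x" using x by linarith
  have "(2 * x + 2) + (8 * Suc x * Suc x + ((6 * ?q + 2) + (2 * ?q + 2))) \<le> 60 * x * x"
  proof -
    have "x \<le> x * x" using x by simp
    moreover have "8 * Suc x * Suc x = 8 * (x * x) + 16 * x + 8" by (simp add: algebra_simps)
    moreover have "60 * x * x = 60 * (x * x)" by simp
    ultimately show ?thesis using q x by linarith
  qed
  then show ?thesis using lead_trans[OF 1 lead_trans[OF 2 lead_trans[OF 3 4 le_refl] le_refl]] by simp
qed

text \<open>In the synchronous division \<open>C\<close> (running to \<open>B\<close> and back) and \<open>X\<close> (running towards \<open>B\<close>)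
  follow the same clock of period 3: \<open>C\<close> moves in phases 0 and 1, \<open>X\<close> in phase 2. They
  meet after exactly \<open>2x\<close> ticks.\<close>

definition race :: "nat \<Rightarrow> cell \<Rightarrow> cell \<Rightarrow> cell \<Rightarrow> ctrl \<Rightarrow> nat \<Rightarrow> state config" where
  "race x p y z g t = (let s = 2 * (t div 3) + t mod 3 in
     cfg (if s \<le> x then RunL (t mod 3) else RunR (t mod 3)) g (Suc (t mod 3))
       (five (off p (if s \<le> x then x - s else s - x)) p (off p (x - t div 3)) y z))"

text \<open>By time \<open>t\<close> the controller has made \<open>s\<close> moves and
  \<open>X\<close> has made \<open>t div 3\<close>, with \<open>s + t div 3 = t\<close>. On the way
  back they share a cell iff this sum is \<open>2 * x\<close>, so \<open>X\<close> is not stopped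
  earlier.\<close>

lemma tick_race:
  assumes sync and x: "0 < x" and p: "length p = n" and t: "t < 2 * x"
  shows "agr m (tick (race x p y z g t)) (race x p y z g (Suc t))"
proof -
  define q where "q = t div 3"
  note [simp] = p
  have "t mod 3 < 3" by simp
  then consider "t mod 3 = 0" | "t mod 3 = 1" | "t mod 3 = 2" by linarith
  then show ?thesis
  proof cases
    case 1
    then have t': "t = 3 * q" using mult_div_mod_eq[of 3 t] by (simp add: q_def)
    then have "Suc t div 3 = q" "Suc t mod 3 = 1" "t div 3 = q" "t mod 3 = 0" by auto
    then show ?thesis using assms(1) t x unfolding t'
      by (auto simp: agr_sync cfg_apply tick_0 tick_idle tick_running race_def Let_def)
  next
    case 2
    then have t': "t = Suc (3 * q)" using mult_div_mod_eq[of 3 t] by (simp add: q_def)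
    then have "Suc t div 3 = q" "Suc t mod 3 = 2" "t div 3 = q" "t mod 3 = 1" by presburger+
    then show ?thesis using assms(1) t x unfolding t'
      by (auto simp: agr_sync cfg_apply tick_0 tick_idle tick_running race_def Let_def)
  next
    case 3
    then have t': "t = Suc (Suc (3 * q))" using mult_div_mod_eq[of 3 t] by (simp add: q_def)
    then have "Suc t div 3 = Suc q" "Suc t mod 3 = 0" "t div 3 = q" "t mod 3 = 2" by presburger+
    then show ?thesis using assms(1) t x unfolding t'
      by (auto simp: agr_sync cfg_apply tick_0 tick_idle tick_running race_def Let_def)
  qed
qed

text \<open>Evaluates the race at time \<open>2 * x\<close>: the controller is on its way back, both
  are at a third of the distance, and twice the phase gives the remainder.\<close>

lemma meeting_point:
  fixes x :: nat
  assumes x: "0 < x"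
  shows "x < 2 * (2 * x div 3) + 2 * x mod 3"
    "2 * (2 * x div 3) + 2 * x mod 3 - x = (x + 2) div 3"
    "x - 2 * x div 3 = (x + 2) div 3"
    "2 * (2 * x mod 3) mod 3 = x mod 3"
proof -
  have "2 * (2 * x div 3) + 2 * x mod 3 + 2 * x div 3 = 2 * x" by simp
  moreover have "2 * x div 3 < x" using x by linarith
  ultimately show "x < 2 * (2 * x div 3) + 2 * x mod 3"
    "2 * (2 * x div 3) + 2 * x mod 3 - x = (x + 2) div 3"
    by linarith+
  show "x - 2 * x div 3 = (x + 2) div 3" by linarith
  show "2 * (2 * x mod 3) mod 3 = x mod 3"
    by (simp add: mod_mult_right_eq mod_mult_left_eq) presburger
qed

text \<open>One tick starts the clock of \<open>X\<close>, the race takes \<open>2 * x\<close>, and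
  in one more \<open>X\<close> stops while the controller reads off the remainder.\<close>

lemma lead_divide_sync:
  assumes sync and p: "length p = n" and x: "0 < x"
  shows "lead (2 * x + 2) (K Divide g (off p x) p (off p x) y z)
    (K (Rest (x mod 3)) g (off p ((x + 2) div 3)) p (off p ((x + 2) div 3)) y z)"
proof -
  have 1: "lead 1 (K Divide g (off p x) p (off p x) y z) (race x p y z g 0)"
    using assms by (intro lead_tick)
     (auto simp: agr_sync cfg_apply tick_0 tick_idle race_def Let_def)
  have "lead t (race x p y z g 0) (race x p y z g t)" if "t \<le> 2 * x" for t
    using that
  proof (induction t)
    case (Suc t)
    show ?case
      by (rule lead_trans[OF Suc.IH lead_tick[OF tick_race]]) (use assms Suc.prems in auto)
  qed simp
  then have 2: "lead (2 * x) (race x p y z g 0) (race x p y z g (2 * x))" by simp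
  let ?q = "(x + 2) div 3"
  have r: "race x p y z g (2 * x) = cfg (RunR (2 * x mod 3)) g (Suc (2 * x mod 3))
      (five (off p ?q) p (off p ?q) y z)"
    using meeting_point[OF x] by (simp only: race_def Let_def not_le[symmetric] if_False)
  have "lead 1 (race x p y z g (2 * x)) (K (Rest (x mod 3)) g (off p ?q) p (off p ?q) y z)"
    unfolding r by (rule lead_tick)
      (use assms meeting_point(4)[OF x] in \<open>simp add: agr_sync cfg_apply tick_0 tick_idle tick_running\<close>)
  from lead_trans[OF 1 lead_trans[OF 2 this le_refl] le_refl] show ?thesis by simp
qed

section \<open>Repeated division and one step of the tour\<close>

definition cost_exp :: nat where "cost_exp = (if sync then 1 else 2)"

lemma lead_divide:
  assumes g: "fst g < n" and p: "length p = n" and y: "length y = n" and x: "0 < x"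
  shows "lead (60 * x ^ cost_exp) (K Divide g (off p x) p (off p x) y p)
    (K (Rest (x mod 3)) g (off p ((x + 2) div 3)) p (off p ((x + 2) div 3)) y p)"
proof (cases sync)
  case True
  then show ?thesis by (intro lead_mono[OF lead_divide_sync[OF True p x, of g y p]])
      (use x in \<open>simp add: cost_exp_def\<close>)
next
  case False
  then show ?thesis using lead_divide_semi[OF False g p y x] by (simp add: cost_exp_def power2_eq_square mult.assoc)
qed


text \<open>The distance falls to a third each time, so the costs are dominated by a geometric
  series: \<open>60 + 2 + 100 / 3 \<le> 100\<close>.\<close>

lemma lead_divides:
  assumes g: "fst g < n" and p: "length p = n" and y: "length y = n" and x: "0 < x"
  shows "\<exists>x' \<le> x. 0 < x' \<and> lead (100 * x ^ cost_exp) (K Divide g (off p x) p (off p x) y p)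
    (K (Carry (if core3 x \<le> 2 then core3 x else 0)) (set_dim ((fst g + val3 x) mod n) g)
      (off p x') p (off p x') y p)"
  using g x
proof (induction x arbitrary: g rule: less_induct)
  case (less x)
  note lens [simp] = p y
  let ?g = "\<lambda>x g. set_dim ((fst g + val3 x) mod n) g"
  let ?u = "\<lambda>x. if core3 x \<le> 2 then core3 x else 0"
  note 1 = lead_divide[OF less.prems(1) p y less.prems(2)]
  show ?case
  proof (cases "x mod 3 = 0")
    case True
    then obtain q where q: "x = 3 * q" by auto
    have fst_sd: "fst (set_dim i g) = i" "set_dim i (set_dim j g) = set_dim i g" for i j
      by (simp_all add: set_dim_def split: prod.splits)
    let ?g' = "set_dim (Suc (fst g) mod n) g"
    have q0: "0 < q" "q < x" using less.prems q by auto
    have g': "fst ?g' < n" using n_pos by (simp add: fst_sd)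
    from less.IH[OF q0(2) g' q0(1)] obtain x' where x': "x' \<le> q" "0 < x'"
      and 3: "lead (100 * q ^ cost_exp) (K Divide ?g' (off p q) p (off p q) y p)
        (K (Carry (?u q)) (?g q ?g') (off p x') p (off p x') y p)" by blast
    have 2: "lead 2 (K (Rest (x mod 3)) g (off p ((x + 2) div 3)) p (off p ((x + 2) div 3)) y p)
       (K Divide ?g' (off p q) p (off p q) y p)"
    proof -
      have "Suc (Suc (3 * q)) div 3 = q" by presburger
      then show ?thesis using less.prems(1) by (intro lead_exec) (simp_all add: q exec_def Let_def)
    qed
    have "?g q ?g' = ?g x g" using q0 by (simp add: q fst_sd val3_triple mod_add_left_eq)
    moreover have "?u q = ?u x" using q0 by (simp add: q core3_triple)
    moreover have "60 * x ^ cost_exp + (2 + 100 * q ^ cost_exp) \<le> 100 * x ^ cost_exp"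
    proof -
      have "3 * q ^ cost_exp \<le> x ^ cost_exp" unfolding cost_exp_def q by (auto simp: power2_eq_square)
      moreover have "1 \<le> q ^ cost_exp" using q0 by (simp add: Suc_le_eq)
      ultimately show ?thesis by linarith
    qed
    ultimately show ?thesis
      using lead_mono[OF lead_trans[OF 1 lead_trans[OF 2 3 le_refl] le_refl]] x' q0
      by (intro exI[of _ x']) auto
  next
    case False
    define x' where "x' = (x + 2) div 3"
    have x': "0 < x'" "x' \<le> x" using less.prems False by (auto simp: x'_def)
    have core: "core3 x = x" "val3 x = 0" using False by (simp_all add: core3.simps[of x] val3.simps[of x])
    have sd: "set_dim (fst g) g = g" by (simp add: set_dim_def split: prod.splits)
    \<comment> \<open>For \<open>x\<close> prime to 3 the rounded quotient is 1 iff \<open>x\<close>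
      is 1 or 2, which is what \<open>Unit\<close> tests.\<close>
    have u: "?u x = (if x' = 1 then x mod 3 else 0)"
    proof (cases "x \<le> 2")
      case True
      then have "x = 1 \<or> x = 2" using less.prems by auto
      then show ?thesis by (auto simp: core x'_def)
    next
      case False
      then have "x' \<noteq> 1" using \<open>x mod 3 \<noteq> 0\<close> by (cases "x = 3") (auto simp: x'_def)
      then show ?thesis using False by (simp add: core)
    qed
    have 2: "lead 4 (K (Rest (x mod 3)) g (off p x') p (off p x') y p)
       (K (Carry (?u x)) g (off p x') p (off p x') y p)"
    proof -
      obtain k where k: "x' = Suc k" using x' by (cases x') auto
      show ?thesis
      proof (cases k)
        case 0
        then show ?thesis unfolding u k using less.prems(1) False
          by - (rule lead_exec; simp add: exec_def Let_def)+
      next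
        case (Suc j)
        then show ?thesis unfolding u k using less.prems(1) False
          by - (rule lead_exec; simp add: exec_def Let_def)+
      qed
    qed
    have "1 \<le> x ^ cost_exp" using less.prems by (simp add: Suc_le_eq)
    then have "60 * x ^ cost_exp + 4 \<le> 100 * x ^ cost_exp" by linarith
    from lead_trans[OF 1 2[unfolded x'_def] this] show ?thesis
      using x' less.prems(1) by (intro exI[of _ x']) (simp add: core sd x'_def)
  qed
qed


lemma lead_carry:
  assumes g: "fst g < n" and p: "length p = n" and z: "length z = n"
  shows "lead (6 * d) (K (Carry u) g (off p x) p (off p x) (off p (x + d)) z)
    (K (Carry u) g (off p (x + d)) p (off p (x + d)) (off p (x + d)) z)"
proof (induction d arbitrary: x)
  case (Suc d)
  have "lead 6 (K (Carry u) g (off p x) p (off p x) (off p (x + Suc d)) z)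
     (K (Carry u) g (off p (Suc x)) p (off p (Suc x)) (off p (x + Suc d)) z)"
    using assms by - (rule lead_exec; simp add: exec_def Let_def)+
  from lead_trans[OF this, of "6 * d"] show ?case using Suc[of "Suc x"] by simp
qed simp

text \<open>The invariant between steps of the tour: the step number is stored as the distance of
  \<open>Y\<close> from \<open>B\<close>.\<close>

abbreviation rest :: "nat \<Rightarrow> ctrl \<Rightarrow> cell \<Rightarrow> state config" where
  "rest N g p \<equiv> K Top g (off p N) p (off p N) (off p N) p"

lemma apply_dir_neq: "fst g < n \<Longrightarrow> length p = n \<Longrightarrow> apply_move (dir g) p \<noteq> p"
  by (rule apply_move_neq) (auto simp: dir_def heading_def split: prod.splits if_splits)

text \<open>All agents make the same move, which commutes with \<open>off\<close>, so the stored
  distance survives. The signs are turned only with the last move, after everyone has used the old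
  ones.\<close>

lemma lead_shift:
  assumes g: "fst g < n" and p: "length p = n"
  shows "lead (4 * N + 16) (K ShiftX g (off p N) p (off p N) (off p N) p)
    (rest N (turn n g) (apply_move (dir g) p))"
proof -
  note [simp] = g p
  let ?p = "apply_move (dir g) p"
  have [simp]: "fst (turn n g) = fst g" by (simp add: turn_def split: prod.splits)
  have d [simp]: "apply_move (dir g) p \<noteq> p"
    using assms by (rule apply_dir_neq)
  have 1: "lead 4 (K ShiftX g (off p N) p (off p N) (off p N) p) (K SeekB g (off p N) p (off ?p N) (off ?p N) p)"
    by (rule lead_exec; simp add: exec_def Let_def)+
  have 2: "lead (2 * N + 2) (K SeekB g (off p N) p (off ?p N) (off ?p N) p)
     (K ShiftB g p p (off ?p N) (off ?p N) p)"
    using lead_seek_left[of SeekB g 1 ShiftB g p "five p p (off ?p N) (off ?p N) p" 0 N] by simp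
  have 3: "lead 6 (K ShiftB g p p (off ?p N) (off ?p N) p)
     (K SeekX (turn n g) ?p ?p (off ?p N) (off ?p N) ?p)"
    by (rule lead_exec; simp add: exec_def Let_def)+
  have 4: "lead (2 * N + 2) (K SeekX (turn n g) ?p ?p (off ?p N) (off ?p N) ?p)
     (rest N (turn n g) ?p)"
    using lead_seek_right[of SeekX "turn n g" 2 Top "turn n g" ?p "five ?p ?p (off ?p N) (off ?p N) ?p" 0 N] by simp
  show ?thesis
    by (rule lead_trans[OF 1 lead_trans[OF 2 lead_trans[OF 3 4 le_refl] le_refl]]) simp
qed

lemma lead_tour_step:
  assumes g: "fst g < n" and p: "length p = n"
  shows "lead (140 * Suc N ^ cost_exp) (rest N g p)
    (rest (Suc N) (fst (tour_step n (Suc N) (g, p))) (snd (tour_step n (Suc N) (g, p))))"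
proof -
  note [simp] = g p
  let ?M = "Suc N"
  let ?g = "set_dim (val3 ?M mod n) g" and ?u = "if core3 ?M \<le> 2 then core3 ?M else 0"
  have [simp]: "fst (set_dim i g) = i" "set_dim i (set_dim j g) = set_dim i g" for i j
    by (simp_all add: set_dim_def split: prod.splits)
  have [simp]: "val3 ?M mod n < n" using n_pos by simp
  have 1: "lead 6 (rest N g p) (K Divide (set_dim 0 g) (off p ?M) p (off p ?M) (off p ?M) p)"
    by (rule lead_exec; simp add: exec_def Let_def)+
  obtain x where x: "x \<le> ?M" and 2: "lead (100 * ?M ^ cost_exp)
      (K Divide (set_dim 0 g) (off p ?M) p (off p ?M) (off p ?M) p)
      (K (Carry ?u) ?g (off p x) p (off p x) (off p ?M) p)"
    using lead_divides[of "set_dim 0 g" p "off p ?M" ?M] n_pos by auto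
  have 3: "lead (6 * (?M - x)) (K (Carry ?u) ?g (off p x) p (off p x) (off p ?M) p)
      (K (Carry ?u) ?g (off p ?M) p (off p ?M) (off p ?M) p)"
    using lead_carry[of ?g p p "?M - x" ?u x] x by simp
  have 4: "lead (4 * ?M + 18) (K (Carry ?u) ?g (off p ?M) p (off p ?M) (off p ?M) p)
    (rest ?M (fst (tour_step n ?M (g, p))) (snd (tour_step n ?M (g, p))))"
  proof (cases "core3 ?M = 1 \<or> core3 ?M = 2")
    case True
    then show ?thesis
      by (intro lead_exec) (auto simp: exec_def Let_def tour_step_def)
  next
    case False
    then show ?thesis
      using core3_pos[of ?M] lead_shift[of ?g p ?M] 
      by (intro lead_exec) (auto simp: exec_def Let_def tour_step_def)
  qed
  have "6 + (100 * A + (6 * (?M - x) + (4 * ?M + 18))) \<le> 140 * A" if "?M \<le> A" for A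
    using that by simp
  from this[of "?M ^ cost_exp"]
  have "6 + (100 * ?M ^ cost_exp + (6 * (?M - x) + (4 * ?M + 18))) \<le> 140 * ?M ^ cost_exp"
    by (simp add: cost_exp_def power2_eq_square)
  from lead_trans[OF 1 lead_trans[OF 2 lead_trans[OF 3 4 le_refl] le_refl] this] show ?thesis .
qed

text \<open>Each of the \<open>N\<close> steps costs at most the bound for the last one.\<close>

lemma lead_tour:
  "length (snd (tour n N)) = n \<and> fst (fst (tour n N)) < n \<and>
   lead (140 * (N * N ^ cost_exp)) (rest 0 (0, 0, {}) (replicate n 0))
     (rest N (fst (tour n N)) (snd (tour n N)))"
proof (induction N)
  case 0
  show ?case using n_pos by simp
next
  case (Suc N)
  obtain g p where gp: "tour n N = (g, p)" by fastforce
  then have g: "fst g < n" and p: "length p = n" using Suc by auto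
  have "N * N ^ cost_exp \<le> N * Suc N ^ cost_exp" by (intro mult_left_mono power_mono) auto
  then have "140 * (N * N ^ cost_exp) + 140 * Suc N ^ cost_exp \<le> 140 * (Suc N * Suc N ^ cost_exp)"
    by simp
  from lead_trans[OF _ lead_tour_step[OF g p, of N] this] Suc
  have "lead (140 * (Suc N * Suc N ^ cost_exp)) (rest 0 (0, 0, {}) (replicate n 0))
     (rest (Suc N) (fst (tour n (Suc N))) (snd (tour n (Suc N))))" by (simp add: gp)
  moreover have "length (snd (tour n (Suc N))) = n"
    using p by (simp add: gp tour_step_def Let_def)
  moreover have "fst (fst (tour n (Suc N))) < n"
    using n_pos by (simp add: gp tour_step_def Let_def set_dim_def next_orthant_def flip_all_def turn_def
      split: prod.splits)
  ultimately show ?case by blast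
qed

end

section \<open>Finiteness of the automaton\<close>

text \<open>The counters in labels are clock phases or remainders, hence below 3; this bound makes
  the set of labels finite.\<close>

fun small :: "label \<Rightarrow> bool" where
  "small (RunL j) = (j < 3)"
| "small (RunR j) = (j < 3)"
| "small (Home j) = (j < 3)"
| "small (HomeZ j) = (j < 3)"
| "small (HomeC j) = (j < 3)"
| "small (Back j) = (j < 3)"
| "small (Rest j) = (j < 3)"
| "small (Unit j) = (j < 3)"
| "small (Carry j) = (j < 3)"
| "small (CarryX j) = (j < 3)"
| "small (CarryC j) = (j < 3)"
| "small _ = True"

lemma finite_small: "finite {l. small l}"
proof -
  have "{l. small l} \<subseteq> {Top, TopY, TopC, Divide, Half0, Half0Z, Half0C, Half1, Half1W, Half1X,
      Half1C, Half2, Half2X, Half2C, Half2W, ShiftX, ShiftY, SeekB, ShiftB, ShiftZ, ShiftC, SeekX} \<union>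
      (\<Union>f \<in> {RunL, RunR, Home, HomeZ, HomeC, Back, Rest, Unit, Carry, CarryX, CarryC}. f ` {..<3})"
  proof
    fix l assume "l \<in> {l. small l}"
    then show "l \<in> {Top, TopY, TopC, Divide, Half0, Half0Z, Half0C, Half1, Half1W, Half1X,
      Half1C, Half2, Half2X, Half2C, Half2W, ShiftX, ShiftY, SeekB, ShiftB, ShiftZ, ShiftC, SeekX} \<union>
      (\<Union>f \<in> {RunL, RunR, Home, HomeZ, HomeC, Back, Rest, Unit, Carry, CarryX, CarryC}. f ` {..<3})"
      by (cases l) auto
  qed
  then show ?thesis by (rule finite_subset) auto
qed

definition ctrls :: "nat \<Rightarrow> ctrl set" where
  "ctrls n = {..<n} \<times> {..<2 ^ n} \<times> Pow {..<n}"

text \<open>The bound 4 allows the idle value 0 and the three clock phases.\<close>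

definition states :: "nat \<Rightarrow> state set" where
  "states n = Ctl ` ({l. small l} \<times> ctrls n) \<union> (\<lambda>(k, r). Pas k r) ` ({..<5} \<times> {..<4})"

lemma finite_states: "finite (states n)"
  by (simp add: states_def ctrls_def finite_small)

lemma ctrls_closed:
  assumes "g \<in> ctrls n"
  shows "i < n \<Longrightarrow> set_dim i g \<in> ctrls n" "next_orthant n g \<in> ctrls n"
    "flip_all n g \<in> ctrls n" "turn n g \<in> ctrls n" "fst g < n"
  using assms set_decode_subset[of "Suc (fst (snd g)) mod 2 ^ n" n]
  by (auto simp: ctrls_def set_dim_def next_orthant_def flip_all_def turn_def flip_others_def
      split: prod.splits)

definition valid_move :: "nat \<Rightarrow> move \<Rightarrow> bool" where
  "valid_move n mv \<longleftrightarrow> fst mv \<in> {-1, 1} \<and> snd mv \<le> n"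

lemma valid_dir: "g \<in> ctrls n \<Longrightarrow> valid_move n (dir g)"
  by (auto simp: valid_move_def dir_def heading_def ctrls_def split: if_splits)

definition valid_target :: "nat \<Rightarrow> move \<times> pc \<Rightarrow> bool" where
  "valid_target n a \<longleftrightarrow> valid_move n (fst a) \<and> small (fst (snd a)) \<and> snd (snd a) \<in> ctrls n"

lemma code_valid:
  assumes "0 < n" "small l" "g \<in> ctrls n"
  shows "case code n sy l g of Cmd j mv pc \<Rightarrow> valid_target n (mv, pc)
     | If j a b \<Rightarrow> valid_target n a \<and> valid_target n b"
proof -
  have [simp]: "valid_move n stay" "valid_move n left" "valid_move n right"
    using assms(1) by (auto simp: valid_move_def)
  show ?thesis using assms
    by (cases l) (auto simp: valid_target_def ctrls_closed valid_dir simp del: One_nat_def)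
qed

lemma Ctl_in_states: "Ctl pc \<in> states n \<longleftrightarrow> small (fst pc) \<and> snd pc \<in> ctrls n"
  by (cases pc) (auto simp: states_def)

lemma Pas_in_states: "Pas k r \<in> states n \<longleftrightarrow> k < 5 \<and> r < 4"
  by (auto simp: states_def)

lemma automaton_delta:
  assumes n: "0 < n"
  shows "automaton n (states n) (delta n sy)"
  unfolding automaton_def
proof (intro conjI finite_states ballI allI impI)
  fix q X assume q: "q \<in> states n" and X: "X \<subseteq> states n"
  have st: "valid_move n stay" by (simp add: valid_move_def)
  have lf: "valid_move n left" using n by (simp add: valid_move_def)
  have "fst (delta n sy q X) \<in> states n \<and> valid_move n (snd (delta n sy q X))"
  proof (cases q)
    case (Ctl pc)
    obtain l g where pc: "pc = (l, g)" by (cases pc)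
    then have "small l" "g \<in> ctrls n" using q Ctl by (auto simp: Ctl_in_states)
    from code_valid[OF n this, of sy] q st show ?thesis
      by (auto simp: Ctl pc valid_target_def Ctl_in_states split: instr.splits)
  next
    case (Pas k r)
    have k: "k < 5" "r < 4" using q Pas by (auto simp: Pas_in_states)
    have react: "fst (react n sy k pc) \<in> states n \<and> valid_move n (snd (react n sy k pc))"
      if "Ctl pc \<in> X" for pc
    proof -
      obtain l g where pc: "pc = (l, g)" by (cases pc)
      then have "small l" "g \<in> ctrls n" using that X by (auto simp: Ctl_in_states)
      from code_valid[OF n this, of sy] k st show ?thesis
        by (auto simp: pc valid_target_def Pas_in_states split: instr.splits)
    qed
    have "(\<exists>pc. Ctl pc \<in> X) \<Longrightarrow> Ctl (SOME pc. Ctl pc \<in> X) \<in> X" by (rule someI_ex)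
    then show ?thesis using k st lf react
      by (auto simp: Pas Pas_in_states simp del: react.simps split_paired_Ex One_nat_def)
  qed
  then show "fst (delta n sy q X) \<in> states n" "fst (snd (delta n sy q X)) \<in> {- 1, 1}"
    "snd (snd (delta n sy q X)) \<le> n" by (auto simp: valid_move_def)
qed

section \<open>Renaming states to natural numbers\<close>

lemma observe_map:
  assumes "\<And>j. j < m \<Longrightarrow> c' j = map_prod h id (c j)" "k < m"
  shows "observe m c' k = h ` observe m c k"
proof -
  have obs: "observe m c k = (\<lambda>j. fst (c j)) ` {j. j < m \<and> snd (c j) = snd (c k)}"
    for c :: "'c config" and k
    by (auto simp: observe_def)
  have obs': "observe m c' k = (\<lambda>j. fst (c' j)) ` {j. j < m \<and> snd (c' j) = snd (c' k)}"
    by (auto simp: observe_def)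
  show ?thesis unfolding obs obs' image_image
    by (rule image_cong) (use assms in auto)
qed

text \<open>An injection of the finite state set into \<open>nat\<close> transports the automaton:
  observed sets are decoded by its inverse and new states encoded again.\<close>

lemma encode_states:
  fixes \<delta> :: "'q \<Rightarrow> 'q set \<Rightarrow> 'q \<times> move"
  assumes aut: "automaton n Q \<delta>" and init: "set init \<subseteq> Q"
  obtains Q' :: "nat set" and \<delta>' init' where "automaton n Q' \<delta>'" "length init' = length init"
    "set init' \<subseteq> Q'" "\<And>S t x. reached n \<delta>' init' S t x = reached n \<delta> init S t x"
    "\<And>S t. travelled n \<delta>' init' S t = travelled n \<delta> init S t"
proof -
  have "finite Q" using aut by (simp add: automaton_def)
  from finite_imp_inj_to_nat_seg[OF this] obtain h :: "'q \<Rightarrow> nat" where h: "inj_on h Q" by blast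
  let ?v = "inv_into Q h" and ?m = "length init"
  define \<delta>' where "\<delta>' = (\<lambda>q X. map_prod h id (\<delta> (?v q) (?v ` X)))"
  have closed: "fst (\<delta> q X) \<in> Q" if "q \<in> Q" "X \<subseteq> Q" for q X
    using aut that by (simp add: automaton_def)
  have vh: "?v ` h ` X = X" if "X \<subseteq> Q" for X
    using that h by (auto simp: image_comp inv_into_f_f subset_iff image_iff)
  have \<delta>': "\<delta>' (h q) (h ` X) = map_prod h id (\<delta> q X)" if "q \<in> Q" "X \<subseteq> Q" for q X
    using that h vh by (simp add: \<delta>'_def)
  have A: "automaton n (h ` Q) \<delta>'"
    unfolding automaton_def
  proof (intro conjI ballI allI impI)
    fix q' X' assume "q' \<in> h ` Q" "X' \<subseteq> h ` Q"
    then obtain q X where "q' = h q" "q \<in> Q" "X' = h ` X" "X \<subseteq> Q" by (auto simp: subset_image_iff)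
    then show "fst (\<delta>' q' X') \<in> h ` Q" "fst (snd (\<delta>' q' X')) \<in> {- 1, 1}" "snd (snd (\<delta>' q' X')) \<le> n"
      using aut by (auto simp: \<delta>' automaton_def)
  qed (use \<open>finite Q\<close> in auto)
  have run: "k < ?m \<Longrightarrow> run n \<delta>' (map h init) S t k = map_prod h id (run n \<delta> init S t k) \<and>
      fst (run n \<delta> init S t k) \<in> Q" for S t k
  proof (induction t arbitrary: k)
    case 0
    then show ?case using init by auto
  next
    case (Suc t)
    let ?c = "run n \<delta> init S t" and ?c' = "run n \<delta>' (map h init) S t"
    have sub: "observe ?m ?c k \<subseteq> Q" using Suc.IH by (auto simp: observe_def)
    have "observe ?m ?c' k = h ` observe ?m ?c k"
      using Suc.IH Suc.prems by (intro observe_map) (auto simp: id_def)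
    then show ?case using Suc.IH[OF Suc.prems] sub closed
      by (simp add: step_def \<delta>')
  qed
  have obs: "observe ?m (run n \<delta>' (map h init) S t) k = h ` observe ?m (run n \<delta> init S t) k"
    if "k < ?m" for S t k
    using run that by (intro observe_map) (auto simp: id_def)
  have obsQ: "observe ?m (run n \<delta> init S t) k \<subseteq> Q" for S t k
    using run by (auto simp: observe_def)
  show thesis
  proof (rule that[OF A, of "map h init"])
    show "set (map h init) \<subseteq> h ` Q" using init by auto
    show "reached n \<delta>' (map h init) S t x = reached n \<delta> init S t x" for S t x
      using run by (auto simp: reached_def)
    show "travelled n \<delta>' (map h init) S t = travelled n \<delta> init S t" for S t
      unfolding travelled_def using run obsQ
      by (intro sum.cong) (auto simp: obs \<delta>')
  qed simp
qed

section \<open>From synchronous to semi-synchronous runs\<close>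

definition inert :: "('q \<Rightarrow> 'q set \<Rightarrow> 'q \<times> move) \<Rightarrow> nat \<Rightarrow> 'q config \<Rightarrow> nat \<Rightarrow> bool" where
  "inert \<delta> m c k \<longleftrightarrow> fst (\<delta> (fst (c k)) (observe m c k)) = fst (c k) \<and>
     snd (snd (\<delta> (fst (c k)) (observe m c k))) = 0"

lemma step_inert: "inert \<delta> m c k \<Longrightarrow> step \<delta> m A c k = c k"
  by (auto simp: inert_def step_def apply_move_def prod_eq_iff)

text \<open>Until the one agent \<open>a\<close> that can act is scheduled, the configuration stands
  still; its activation then reproduces the fully active step. At most one agent moves per such
  step, whence the bound on the distance.\<close>

lemma semi_sync_run:
  assumes single: "\<And>i. \<exists>a < length init. \<forall>k < length init. k \<noteq> a \<longrightarrow>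
      inert \<delta> (length init) (run n \<delta> init (\<lambda>_. {..<length init}) i) k"
    and fair: "fair (length init) S"
  shows "\<exists>t. run n \<delta> init S t = run n \<delta> init (\<lambda>_. {..<length init}) i \<and> travelled n \<delta> init S t \<le> i"
proof (induction i)
  case 0
  show ?case by (intro exI[of _ 0]) (simp add: travelled_def)
next
  case (Suc i)
  let ?m = "length init"
  let ?c = "run n \<delta> init (\<lambda>_. {..<?m}) i"
  let ?len = "\<lambda>k. move_len (snd (\<delta> (fst (?c k)) (observe ?m ?c k)))"
  from Suc obtain t where t: "run n \<delta> init S t = ?c" "travelled n \<delta> init S t \<le> i" by auto
  from single obtain a where a: "a < ?m" "\<And>k. k < ?m \<Longrightarrow> k \<noteq> a \<Longrightarrow> inert \<delta> ?m ?c k" by blast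
  have len: "?len k = 0" if "k < ?m" "k \<noteq> a" for k
    using a(2)[OF that] by (simp add: inert_def move_len_def)
  have "infinite {t. a \<in> S t}" using fair a by (simp add: fair_def)
  then obtain t1 where "t \<le> t1" "a \<in> S t1" 
    unfolding finite_nat_set_iff_bounded_le by (metis mem_Collect_eq nat_le_linear)
  then have ex: "\<exists>d. a \<in> S (t + d)" by (metis le_add_diff_inverse)
  \<comment> \<open>The delay until the adversary next activates \<open>a\<close>, which exists by
    fairness.\<close>
  define d where "d = (LEAST d. a \<in> S (t + d))"
  have ad: "a \<in> S (t + d)" unfolding d_def by (rule LeastI_ex[OF ex])
  have "run n \<delta> init S (t + j) = ?c \<and> travelled n \<delta> init S (t + j) \<le> i" if "j \<le> d" for j
    using that
  proof (induction j)
    case 0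
    then show ?case using t by simp
  next
    case (Suc j)
    then have IH: "run n \<delta> init S (t + j) = ?c" "travelled n \<delta> init S (t + j) \<le> i" by auto
    have na: "a \<notin> S (t + j)" using Suc.prems not_less_Least[of j "\<lambda>d. a \<in> S (t + d)"] by (simp add: d_def)
    have "step \<delta> ?m (S (t + j)) ?c k = ?c k" for k
    proof (cases "k \<in> S (t + j) \<and> k < ?m")
      case True
      then show ?thesis using na a(2) by (intro step_inert) auto
    qed (auto simp: step_def)
    moreover have "(\<Sum>k\<in>S (t + j) \<inter> {..<?m}. ?len k) = 0"
      using na len by (intro sum.neutral) auto
    ultimately show ?case using IH by (auto simp: travelled_def)
  qed
  from this[of d] have td: "run n \<delta> init S (t + d) = ?c" "travelled n \<delta> init S (t + d) \<le> i" by auto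
  have "step \<delta> ?m (S (t + d)) ?c k = step \<delta> ?m {..<?m} ?c k" for k
  proof (cases "k \<noteq> a \<and> k < ?m")
    case True
    then show ?thesis using step_inert[OF a(2)] by simp
  qed (use ad a(1) in \<open>auto simp: step_def\<close>)
  moreover have "(\<Sum>k\<in>S (t + d) \<inter> {..<?m}. ?len k) \<le> 1"
  proof -
    have "(\<Sum>k\<in>S (t + d) \<inter> {..<?m}. ?len k) = (\<Sum>k\<in>{a}. ?len k)"
      using ad a(1) len by (intro sum.mono_neutral_right) auto
    then show ?thesis by (simp add: move_len_def)
  qed
  ultimately show ?case using td
    by (intro exI[of _ "Suc (t + d)"]) (auto simp: travelled_def)
qed

section \<open>The concrete runs and their cost\<close>

context machine
begin

definition init :: "state list" where
  "init = Ctl (Top, 0, 0, {}) # map (\<lambda>k. Pas k 0) [1..<m]"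

lemma length_init [simp]: "length init = m"
  by (simp add: init_def)

lemma nth_init: "k < m \<Longrightarrow> init ! k = (if k = 0 then Ctl (Top, 0, 0, {}) else Pas k 0)"
  by (auto simp: init_def nth_Cons split: nat.split)

lemma set_init: "set init \<subseteq> states n"
proof -
  have "m \<le> 5" using m_cases by auto
  then show ?thesis using n_pos by (auto simp: init_def Ctl_in_states Pas_in_states ctrls_def)
qed

abbreviation sync_run :: "nat \<Rightarrow> state config" where
  "sync_run \<equiv> run n (delta n sync) init (\<lambda>_. {..<m})"

lemma sync_run_funpow: "sync_run t = (tick ^^ t) (sync_run 0)"
  by (induction t) (simp_all add: tick_def)

lemma sync_run_0: "agr m (sync_run 0) (rest 0 (0, 0, {}) (replicate n 0))"
  by (simp add: agr_def cfg_apply nth_init five_def)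

text \<open>Collects the constant of \<open>tour_visits\<close>, the \<open>n ^ n\<close> of
  \<open>power_le_ball_card\<close> and the 140 of \<open>lead_tour\<close>.\<close>

definition factor :: nat where
  "factor = 140 * (2 * 3 ^ (n + 2 * 2 ^ n) * n ^ n) ^ Suc cost_exp"

lemma sync_run_visits:
  assumes x: "length x = n"
  shows "\<exists>t \<le> factor * ball_card n (l1 x) ^ Suc cost_exp. reached n (delta n sync) init (\<lambda>_. {..<m}) t x"
proof -
  let ?A = "2 * 3 ^ (n + 2 * 2 ^ n) :: nat" and ?V = "ball_card n (l1 x)"
  obtain N where N: "snd (tour n N) = x" "N \<le> ?A * Suc (l1 x) ^ n"
    using tour_visits[OF n_pos x] by auto
  have "lead (140 * (N * N ^ cost_exp)) (rest 0 (0, 0, {}) (replicate n 0))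
      (rest N (fst (tour n N)) (snd (tour n N)))"
    using lead_tour by blast
  from this[unfolded lead_def, rule_format, OF sync_run_0] obtain t where t: "t \<le> 140 * (N * N ^ cost_exp)"
    "agr m (sync_run t) (rest N (fst (tour n N)) (snd (tour n N)))"
    unfolding sync_run_funpow[symmetric] by blast
  have "snd (sync_run t 1) = x" using t(2) N(1) by (simp add: agr_def cfg_apply)
  then have "reached n (delta n sync) init (\<lambda>_. {..<m}) t x"
    unfolding reached_def by (intro exI[of _ 1]) simp
  moreover have "t \<le> factor * ?V ^ Suc cost_exp"
  proof -
    have "N \<le> ?A * (n ^ n * ?V)"
      using N(2) power_le_ball_card[OF n_pos, of "l1 x"] by (meson le_trans mult_le_mono2)
    then have "N ^ Suc cost_exp \<le> (?A * n ^ n * ?V) ^ Suc cost_exp"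
      by (intro power_mono) (simp_all only: mult.assoc)
    then have "140 * N ^ Suc cost_exp \<le> 140 * (?A * n ^ n * ?V) ^ Suc cost_exp" by (rule mult_le_mono2)
    also have "\<dots> = factor * ?V ^ Suc cost_exp"
      by (simp only: factor_def power_mult_distrib mult.assoc)
    finally show ?thesis using t(1) unfolding power_Suc by (rule le_trans[rotated])
  qed
  ultimately show ?thesis by blast
qed

text \<open>With five agents the clock of \<open>X\<close> never starts, so it stays 0 in every
  configuration.\<close>

lemma sync_run_cfg:
  assumes "\<not> sync"
  shows "\<exists>l g f. agr m (sync_run t) (cfg l g 0 f)"
proof (induction t)
  case 0
  show ?case using sync_run_0 by blast
next
  case (Suc t)
  then obtain l g f where "agr m (sync_run t) (cfg l g 0 f)" by blast
  then have st: "agr m (sync_run (Suc t)) (tick (cfg l g 0 f))"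
    by (simp add: tick_def agr_step)
  have "\<exists>l' g' f'. agr m (tick (cfg l g 0 f)) (cfg l' g' 0 f')"
  proof (cases "code n sync l g")
    case (If j a b)
    then show ?thesis using tick_If[OF If code_If[OF If] _ refl] assms by blast
  next
    case (Cmd j mv pc)
    have "0 < j" using code_Cmd[OF Cmd] by simp
    from tick_Cmd[OF Cmd this, of f] assms show ?thesis
      by (cases "j < m \<and> f j = f 0") (simp_all only: if_True if_False simp_thms, blast+)
  qed
  with st show ?case by (meson agr_trans)
qed

lemma agr_inert: "agr m c d \<Longrightarrow> k < m \<Longrightarrow> inert \<delta> m c k = inert \<delta> m d k"
  by (simp add: inert_def agr_observe) (simp add: agr_def)

text \<open>While a commanded agent is present, the controller waits and only that agent can act;
  otherwise all passive agents idle and only the controller can act.\<close>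

lemma single_active:
  assumes "\<not> sync"
  shows "\<exists>a<m. \<forall>k<m. k \<noteq> a \<longrightarrow> inert (delta n sync) m (sync_run t) k"
proof -
  from sync_run_cfg[OF assms] obtain l g f where c: "agr m (sync_run t) (cfg l g 0 f)" by blast
  have react: "react n sync k (l, g) = (case code n sync l g of
      Cmd k' mv _ \<Rightarrow> (Pas k 0, if k' = k then mv else stay) | If _ _ _ \<Rightarrow> (Pas k 0, stay))" for k
    using assms by simp
  have "\<exists>a<m. \<forall>k<m. k \<noteq> a \<longrightarrow> inert (delta n sync) m (cfg l g 0 f) k"
  proof (cases "\<exists>j mv pc. code n sync l g = Cmd j mv pc \<and> j < m \<and> f j = f 0")
    case True
    then obtain j mv pc where j: "code n sync l g = Cmd j mv pc" "j < m" "f j = f 0" by blast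
    have "0 < j" using code_Cmd[OF j(1)] by simp
    with j show ?thesis
      by (intro exI[of _ j])
        (auto simp: inert_def cfg_apply delta_idle react simp del: delta.simps(2) react.simps)
  next
    case False
    then show ?thesis
      by (intro exI[of _ 0])
        (auto simp: inert_def cfg_apply delta_idle react simp del: delta.simps(2) react.simps
          split: instr.splits)
  qed
  with c show ?thesis by (metis agr_inert)
qed

end

theorem theorem1p3:
  fixes n :: nat
  assumes "n \<ge> 1"
  shows "(\<exists>(Q :: nat set) (\<delta> :: nat \<Rightarrow> nat set \<Rightarrow> nat \<times> move) init (C :: nat).
            automaton n Q \<delta> \<and> length init = 4 \<and> set init \<subseteq> Q \<and>
            (\<forall>x :: cell. length x = n \<longrightarrow>
               (\<exists>t. t \<le> C * ball_card n (l1 x) ^ 2 \<and>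
                    reached n \<delta> init (\<lambda>_. {..<length init}) t x)))
       \<and> (\<exists>(Q :: nat set) (\<delta> :: nat \<Rightarrow> nat set \<Rightarrow> nat \<times> move) init (C :: nat).
            automaton n Q \<delta> \<and> length init = 5 \<and> set init \<subseteq> Q \<and>
            (\<forall>(S :: nat \<Rightarrow> nat set) (x :: cell). fair (length init) S \<and> length x = n \<longrightarrow>
               (\<exists>t. reached n \<delta> init S t x \<and>
                    travelled n \<delta> init S t \<le> C * ball_card n (l1 x) ^ 3)))"
proof
  have n: "0 < n" using assms by simp
  interpret four: machine n 4 by unfold_locales (use n in auto)
  interpret five: machine n 5 by unfold_locales (use n in auto)
  have e: "Suc four.cost_exp = 2" "Suc five.cost_exp = 3" and "\<not> five.sync"
    by (simp_all add: four.cost_exp_def five.cost_exp_def four.sync_def five.sync_def)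
  obtain Q :: "nat set" and \<delta> ini where *: "automaton n Q \<delta>" "length ini = 4" "set ini \<subseteq> Q"
    "\<And>S t x. reached n \<delta> ini S t x = reached n (delta n four.sync) four.init S t x"
    by (rule encode_states[OF automaton_delta[OF n, of four.sync] four.set_init]) (simp only: four.length_init)
  then show "\<exists>(Q :: nat set) (\<delta> :: nat \<Rightarrow> nat set \<Rightarrow> nat \<times> move) init (C :: nat).
            automaton n Q \<delta> \<and> length init = 4 \<and> set init \<subseteq> Q \<and>
            (\<forall>x :: cell. length x = n \<longrightarrow>
               (\<exists>t. t \<le> C * ball_card n (l1 x) ^ 2 \<and>
                    reached n \<delta> init (\<lambda>_. {..<length init}) t x))"
    using four.sync_run_visits[unfolded e]
    by (intro exI[of _ Q] exI[of _ \<delta>] exI[of _ ini] exI[of _ four.factor]) auto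
  obtain Q :: "nat set" and \<delta> ini where *: "automaton n Q \<delta>" "length ini = 5" "set ini \<subseteq> Q"
    "\<And>S t x. reached n \<delta> ini S t x = reached n (delta n five.sync) five.init S t x"
    "\<And>S t. travelled n \<delta> ini S t = travelled n (delta n five.sync) five.init S t"
    by (rule encode_states[OF automaton_delta[OF n, of five.sync] five.set_init]) (simp only: five.length_init)
  have "\<exists>t. reached n \<delta> ini S t x \<and> travelled n \<delta> ini S t \<le> five.factor * ball_card n (l1 x) ^ 3"
    if S: "fair 5 S" and x: "length x = n" for S x
  proof -
    from five.sync_run_visits[OF x] obtain i where i: "i \<le> five.factor * ball_card n (l1 x) ^ 3"
      "reached n (delta n five.sync) five.init (\<lambda>_. {..<5}) i x" unfolding e by blast
    from semi_sync_run[of five.init "delta n five.sync" n S i] five.single_active[OF \<open>\<not> five.sync\<close>] S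
    obtain t where t: "run n (delta n five.sync) five.init S t = five.sync_run i"
      "travelled n (delta n five.sync) five.init S t \<le> i" by auto
    have "reached n (delta n five.sync) five.init S t x" using i(2) unfolding reached_def t(1) .
    then show ?thesis using t(2) i(1) unfolding * by (blast intro: le_trans)
  qed
  then show "\<exists>(Q :: nat set) (\<delta> :: nat \<Rightarrow> nat set \<Rightarrow> nat \<times> move) init (C :: nat).
            automaton n Q \<delta> \<and> length init = 5 \<and> set init \<subseteq> Q \<and>
            (\<forall>(S :: nat \<Rightarrow> nat set) (x :: cell). fair (length init) S \<and> length x = n \<longrightarrow>
               (\<exists>t. reached n \<delta> init S t x \<and>
                    travelled n \<delta> init S t \<le> C * ball_card n (l1 x) ^ 3))"
    using * by (intro exI[of _ Q] exI[of _ \<delta>] exI[of _ ini] exI[of _ five.factor]) auto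
qed

end
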